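(* Let $f,g_1,\dots,g_m\in\mathbb{R}[\mathbf{x}]$ and $\mathbf{X}=\{\mathbf{x}\in\mathbb{R}^n:g_j(\mathbf{x})\ge0,\ j\in[m]\}$. Suppose $I_1,\dots,I_p\subseteq[n]$ with $\bigcup_kI_k=[n]$ and a partition of $[m]$ into pairwise disjoint $J_1,\dots,J_p$ satisfy: (i) $f=f_1+\dots+f_p$ with $f_k\in\mathbb{R}[\mathbf{x}(I_k)]$; (ii) $g_j\in\mathbb{R}[\mathbf{x}(I_k)]$ for all $k\in[p]$ and $j\in J_k$; (iii) $I_1,\dots,I_p$ satisfy the running intersection property; (iv) for each $k\in[p]$ there is $N_k>0$ such that $N_k-\sum_{i\in I_k}x_i^2$ is one of the $g_j$, $j\in J_k$. Let $\mathbf{R}$ be a binary matrix whose columns are the sign symmetries of $\mathscr{A}=\operatorname{supp}(f)\cup\bigcup_{j=1}^m\operatorname{supp}(g_j)$. If $f$ is positive on $\mathbf{X}$, then $$f=\sum_{k=1}^p\Big(\sigma_{k,0}+\sum_{j\in J_k}\sigma_{k,j}g_j\Big)$$ for some sums of squares $\sigma_{k,j}\in\Sigma[\mathbf{x}(I_k)]$, $j\in\{0\}\cup J_k$, $k\in[p]$, satisfying $\mathbf{R}^\intercal\alpha\equiv\mathbf{0}\pmod2$ for every $\alpha\in\operatorname{supp}(\sigma_{k,j})$.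
   Context: $[n]=\{1,\dots,n\}$; $\mathbb{R}[\mathbf{x}(I_k)]$ is the ring of polynomials in the variables $\{x_i\}_{i\in I_k}$ and $\Sigma[\mathbf{x}(I_k)]$ the cone of sums of squares of such polynomials. RIP: for every $k\in[p-1]$ there is $i\le k$ with $I_{k+1}\cap\bigcup_{j\le k}I_j\subseteq I_i$. The sign symmetries of a finite $\mathscr{A}\subseteq\mathbb{N}^n$ are all $\mathbf{s}\in\{0,1\}^n$ with $\mathbf{s}^\intercal\alpha\equiv0\pmod2$ for all $\alpha\in\mathscr{A}$. *)

theory Defs
  imports Complex_Main "HOL-Library.Poly_Mapping"
begin

text \<open>Real multivariate polynomials: finitely supported maps from exponent vectors
  (finitely supported maps variable index to exponent) to real coefficients.
  Variables are indexed by natural numbers; x_1,...,x_n are indices 1..n.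
  Multiplication is the convolution product of Poly_Mapping.\<close>
type_synonym mpoly = "(nat \<Rightarrow>\<^sub>0 nat) \<Rightarrow>\<^sub>0 real"

definition Var :: "nat \<Rightarrow> mpoly" where
  "Var i = Poly_Mapping.single (Poly_Mapping.single i 1) 1"

definition Const :: "real \<Rightarrow> mpoly" where
  "Const c = Poly_Mapping.single 0 c"

abbreviation supp :: "mpoly \<Rightarrow> (nat \<Rightarrow>\<^sub>0 nat) set" where
  "supp p \<equiv> Poly_Mapping.keys p"

definition eval :: "mpoly \<Rightarrow> (nat \<Rightarrow> real) \<Rightarrow> real" where
  "eval p x = (\<Sum>\<alpha>\<in>Poly_Mapping.keys p. Poly_Mapping.lookup p \<alpha> * (\<Prod>i\<in>Poly_Mapping.keys \<alpha>. x i ^ Poly_Mapping.lookup \<alpha> i))"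

definition vars_in :: "nat set \<Rightarrow> mpoly \<Rightarrow> bool" where
  "vars_in I p \<longleftrightarrow> (\<forall>\<alpha>\<in>Poly_Mapping.keys p. Poly_Mapping.keys \<alpha> \<subseteq> I)"

definition sos_in :: "nat set \<Rightarrow> mpoly \<Rightarrow> bool" where
  "sos_in I \<sigma> \<longleftrightarrow> (\<exists>qs. (\<forall>q\<in>set qs. vars_in I q) \<and> \<sigma> = sum_list (map (\<lambda>q. q * q) qs))"

definition RIP :: "nat \<Rightarrow> (nat \<Rightarrow> nat set) \<Rightarrow> bool" where
  "RIP p I \<longleftrightarrow> (\<forall>k\<in>{1..p-1}. \<exists>i\<in>{1..k}. I (k+1) \<inter> (\<Union>j\<in>{1..k}. I j) \<subseteq> I i)"

text \<open>s^T alpha for s in {0,1}^n, represented by the set S = {i. s_i = 1} \<subseteq> [n]\<close>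
definition sdot :: "nat set \<Rightarrow> (nat \<Rightarrow>\<^sub>0 nat) \<Rightarrow> nat" where
  "sdot S \<alpha> = (\<Sum>i\<in>S. Poly_Mapping.lookup \<alpha> i)"

definition sign_symmetries :: "nat \<Rightarrow> (nat \<Rightarrow>\<^sub>0 nat) set \<Rightarrow> nat set set" where
  "sign_symmetries n A = {S. S \<subseteq> {1..n} \<and> (\<forall>\<alpha>\<in>A. even (sdot S \<alpha>))}"

end

theory Submission
  imports Defs "HOL-Analysis.Analysis"
begin

text \<open>Splitting off one block at a time along the running intersection property, \<open>f\<close> is rewritten
  as a sum of polynomials \<open>h\<^sub>k\<close> in the variables \<open>x(I\<^sub>k)\<close>, each positive on the set cut out by its
  own constraints: the positivity of \<open>f\<close> leaves room for a continuous function of the shared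
  variables, which Stone--Weierstrass replaces by a polynomial. Every block is archimedean, so
  Putinar's theorem represents \<open>h\<^sub>k\<close>; it is obtained from real characters of maximal proper quadratic
  modules. Finally, the projection onto the monomials that are even for all sign symmetries fixes
  \<open>f\<close>, commutes with multiplication by the \<open>g\<^sub>j\<close>, and maps \<open>q\<^sup>2\<close> to the sum of the squares of the parity
  components of \<open>q\<close>.\<close>

section \<open>Evaluation of polynomials\<close>

text \<open>The summands of \<open>f\<close> carry no sign on the feasible set of a single block,
  which contains \<open>X\<close> and may be much larger, so positivity must be moved between
  blocks. The polynomial exchanged between a block and the union of its predecessors uses only
  variables common to both. The running intersection property places all of these in one earlier
  \<open>I i\<close>, so one summand can absorb the exchange without acquiring new variables. The
  ball constraint of each block serves twice: analytically, it bounds the coordinates and gives the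
  compactness behind the exchange; algebraically, it makes the quadratic module of the block
  archimedean. Parity can wait until the end, since deleting monomials never introduces a variable:
  the projection respects the sparsity pattern already obtained.\<close>

definition monom_eval :: "(nat \<Rightarrow>\<^sub>0 nat) \<Rightarrow> (nat \<Rightarrow> real) \<Rightarrow> real" where
  "monom_eval \<alpha> x = (\<Prod>i\<in>Poly_Mapping.keys \<alpha>. x i ^ Poly_Mapping.lookup \<alpha> i)"

lemma monom_eval_superset:
  assumes "finite S" "Poly_Mapping.keys \<alpha> \<subseteq> S"
  shows "monom_eval \<alpha> x = (\<Prod>i\<in>S. x i ^ Poly_Mapping.lookup \<alpha> i)"
  unfolding monom_eval_def
  by (rule prod.mono_neutral_left) (use assms in \<open>auto simp: in_keys_iff\<close>)

lemma monom_eval_add: "monom_eval (\<alpha> + \<beta>) x = monom_eval \<alpha> x * monom_eval \<beta> x"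
proof -
  let ?S = "Poly_Mapping.keys \<alpha> \<union> Poly_Mapping.keys \<beta>"
  show ?thesis
    using monom_eval_superset[of ?S \<alpha> x] monom_eval_superset[of ?S \<beta> x]
      monom_eval_superset[of ?S "\<alpha> + \<beta>" x] Poly_Mapping.keys_add[of \<alpha> \<beta>]
    by (simp add: lookup_add power_add prod.distrib)
qed

text \<open>Cancellation makes the support of a sum unpredictable. Summing over a common finite
  superset avoids any case distinction on it.\<close>

lemma eval_superset:
  assumes "finite S" "supp q \<subseteq> S"
  shows "eval q x = (\<Sum>\<alpha>\<in>S. Poly_Mapping.lookup q \<alpha> * monom_eval \<alpha> x)"
  unfolding eval_def monom_eval_def
  by (rule sum.mono_neutral_left) (use assms in \<open>auto simp: in_keys_iff\<close>)

lemma eval_add: "eval (q + r) x = eval q x + eval r x"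
  using eval_superset[of "supp q \<union> supp r" q x] eval_superset[of "supp q \<union> supp r" r x]
    eval_superset[of "supp q \<union> supp r" "q + r" x] Poly_Mapping.keys_add[of q r]
  by (simp add: lookup_add distrib_right sum.distrib)

lemma eval_zero: "eval 0 x = 0"
  by (simp add: eval_def)

lemma eval_sum: "eval (\<Sum>a\<in>S. q a) x = (\<Sum>a\<in>S. eval (q a) x)"
  by (induction S rule: infinite_finite_induct) (auto simp: eval_add eval_zero)

lemma eval_single: "eval (Poly_Mapping.single \<alpha> c) x = c * monom_eval \<alpha> x"
  by (subst eval_superset[of "{\<alpha>}"]) auto

text \<open>Polymorphic because it is applied at two levels: to split a polynomial into monomials
  and to split an exponent vector into powers of variables.\<close>

lemma sum_single_lookup:
  fixes q :: "'a \<Rightarrow>\<^sub>0 'b::comm_monoid_add"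
  shows "(\<Sum>\<alpha>\<in>Poly_Mapping.keys q. Poly_Mapping.single \<alpha> (Poly_Mapping.lookup q \<alpha>)) = q"
proof (rule poly_mapping_eqI)
  fix \<beta>
  show "Poly_Mapping.lookup (\<Sum>\<alpha>\<in>Poly_Mapping.keys q. Poly_Mapping.single \<alpha> (Poly_Mapping.lookup q \<alpha>)) \<beta>
      = Poly_Mapping.lookup q \<beta>"
    by (cases "\<beta> \<in> Poly_Mapping.keys q")
      (auto simp: lookup_sum lookup_single when_def in_keys_iff)
qed

lemma eval_eq: "eval q x = (\<Sum>\<alpha>\<in>supp q. Poly_Mapping.lookup q \<alpha> * monom_eval \<alpha> x)"
  by (simp add: eval_def monom_eval_def)

lemma eval_mult: "eval (q * r) x = eval q x * eval r x"
proof -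
  have "q * r = (\<Sum>\<alpha>\<in>supp q. Poly_Mapping.single \<alpha> (Poly_Mapping.lookup q \<alpha>))
      * (\<Sum>\<beta>\<in>supp r. Poly_Mapping.single \<beta> (Poly_Mapping.lookup r \<beta>))"
    by (simp only: sum_single_lookup)
  also have "\<dots> = (\<Sum>\<alpha>\<in>supp q. \<Sum>\<beta>\<in>supp r. Poly_Mapping.single (\<alpha> + \<beta>)
      (Poly_Mapping.lookup q \<alpha> * Poly_Mapping.lookup r \<beta>))"
    by (simp only: sum_product mult_single)
  finally have "eval (q * r) x = (\<Sum>\<alpha>\<in>supp q. \<Sum>\<beta>\<in>supp r.
      Poly_Mapping.lookup q \<alpha> * Poly_Mapping.lookup r \<beta> * (monom_eval \<alpha> x * monom_eval \<beta> x))"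
    by (simp only: eval_sum eval_single monom_eval_add)
  then show ?thesis
    unfolding eval_eq[of q] eval_eq[of r] by (simp only: sum_product mult_ac)
qed

lemma eval_Const: "eval (Const c) x = c"
  by (simp add: Const_def eval_single monom_eval_def)

lemma eval_Var: "eval (Var i) x = x i"
  by (simp add: Var_def eval_single monom_eval_def)

lemma Const_add: "Const (a + b) = Const a + Const b"
  by (simp add: Const_def single_add)

lemma Const_mult: "Const (a * b) = Const a * Const b"
  by (simp add: Const_def mult_single)

lemma Const_one: "Const 1 = 1"
  by (simp add: Const_def)

lemma eval_uminus: "eval (- q) x = - eval q x"
  using eval_add[of q "- q" x] by (simp add: eval_zero)

lemma eval_diff: "eval (q - r) x = eval q x - eval r x"
  using eval_add[of q "- r" x] by (simp add: eval_uminus)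

lemma eval_cong:
  assumes "vars_in I q" "\<And>i. i \<in> I \<Longrightarrow> x i = y i"
  shows "eval q x = eval q y"
  unfolding eval_def
proof (intro sum.cong prod.cong refl arg_cong2[of _ _ _ _ "(*)"])
  fix \<alpha> i assume "\<alpha> \<in> supp q" "i \<in> Poly_Mapping.keys \<alpha>"
  then show "x i ^ Poly_Mapping.lookup \<alpha> i = y i ^ Poly_Mapping.lookup \<alpha> i"
    using assms unfolding vars_in_def by fastforce
qed

lemma vars_in_mono: "vars_in I q \<Longrightarrow> I \<subseteq> I' \<Longrightarrow> vars_in I' q"
  unfolding vars_in_def by blast

lemma vars_in_add: "vars_in I q \<Longrightarrow> vars_in I r \<Longrightarrow> vars_in I (q + r)"
  unfolding vars_in_def using Poly_Mapping.keys_add[of q r] by blast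

lemma vars_in_zero: "vars_in I 0"
  by (simp add: vars_in_def)

lemma vars_in_sum: "(\<And>a. a \<in> S \<Longrightarrow> vars_in I (q a)) \<Longrightarrow> vars_in I (\<Sum>a\<in>S. q a)"
  by (induction S rule: infinite_finite_induct) (auto simp: vars_in_add vars_in_zero)

lemma vars_in_uminus: "vars_in I q \<Longrightarrow> vars_in I (- q)"
  by (simp add: vars_in_def in_keys_iff)

lemma vars_in_diff: "vars_in I q \<Longrightarrow> vars_in I r \<Longrightarrow> vars_in I (q - r)"
  using vars_in_add[of I q "- r"] vars_in_uminus by simp

lemma vars_in_mult: "vars_in I q \<Longrightarrow> vars_in I r \<Longrightarrow> vars_in I (q * r)"
  unfolding vars_in_def
proof
  fix \<gamma> assume "\<forall>\<alpha>\<in>supp q. Poly_Mapping.keys \<alpha> \<subseteq> I" "\<forall>\<alpha>\<in>supp r. Poly_Mapping.keys \<alpha> \<subseteq> I" "\<gamma> \<in> supp (q * r)"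
  moreover from this obtain \<alpha> \<beta> where "\<gamma> = \<alpha> + \<beta>" "\<alpha> \<in> supp q" "\<beta> \<in> supp r"
    using keys_mult[of q r] by blast
  ultimately show "Poly_Mapping.keys \<gamma> \<subseteq> I"
    using Poly_Mapping.keys_add[of \<alpha> \<beta>] by blast
qed

lemma vars_in_Const: "vars_in I (Const c)"
  by (auto simp: vars_in_def Const_def split: if_splits)

lemma vars_in_Var: "i \<in> I \<Longrightarrow> vars_in I (Var i)"
  by (auto simp: vars_in_def Var_def)

lemma continuous_on_eval: "continuous_on S (eval q)"
proof -
  have "continuous_on S (\<lambda>x. x i)" for i :: nat
    by (rule continuous_on_subset[OF continuous_on_product_coordinates]) simp
  then show ?thesis
    unfolding eval_def by (intro continuous_on_sum continuous_on_mult continuous_on_prod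
        continuous_on_power continuous_on_const)
qed

lemma single_eq_Const_Var:
  "Poly_Mapping.single \<alpha> c = Const c * (\<Prod>i\<in>Poly_Mapping.keys \<alpha>. Var i ^ Poly_Mapping.lookup \<alpha> i)"
proof -
  have power: "Var i ^ n = Poly_Mapping.single (Poly_Mapping.single i n) 1" for i n
  proof (induction n)
    case (Suc n)
    then show ?case by (simp add: Var_def mult_single single_add[symmetric])
  qed simp
  have "(\<Prod>i\<in>S. Poly_Mapping.single (\<beta> i) (1::real)) = Poly_Mapping.single (\<Sum>i\<in>S. \<beta> i) 1"
    for S :: "nat set" and \<beta> :: "nat \<Rightarrow> nat \<Rightarrow>\<^sub>0 nat"
    by (induction S rule: infinite_finite_induct) (auto simp: mult_single)
  then show ?thesis
    by (simp only: power Const_def mult_single sum_single_lookup) simp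
qed

text \<open>Constants and variables generate the algebra of polynomials in \<open>I\<close>. The
  proof carries \<open>P\<close> together with \<open>vars_in\<close>, because the cases
  \<open>add\<close> and \<open>mult\<close> require operands from that algebra.\<close>

lemma vars_in_induct [consumes 1, case_names Const Var add mult]:
  assumes q: "vars_in I q"
    and Const: "\<And>c. P (Const c)"
    and Var: "\<And>i. i \<in> I \<Longrightarrow> P (Var i)"
    and add: "\<And>a b. vars_in I a \<Longrightarrow> vars_in I b \<Longrightarrow> P a \<Longrightarrow> P b \<Longrightarrow> P (a + b)"
    and mult: "\<And>a b. vars_in I a \<Longrightarrow> vars_in I b \<Longrightarrow> P a \<Longrightarrow> P b \<Longrightarrow> P (a * b)"
  shows "P q"
proof -
  have power: "P (Var i ^ n) \<and> vars_in I (Var i ^ n)" if "i \<in> I" for i n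
  proof (induction n)
    case (Suc n)
    then show ?case
      using mult[OF vars_in_Var[OF that] _ Var[OF that]] vars_in_mult[OF vars_in_Var[OF that]] by auto
  qed (use Const[of 1] vars_in_Const[of I 1] in \<open>auto simp: Const_one\<close>)
  have prod: "P (\<Prod>i\<in>S. Var i ^ e i) \<and> vars_in I (\<Prod>i\<in>S. Var i ^ e i)" if "S \<subseteq> I" for S e
    using that
  proof (induction S rule: infinite_finite_induct)
    case (insert i S)
    then have "i \<in> I" by blast
    from power[OF this, of "e i"] insert show ?case
      using mult vars_in_mult by simp
  qed (use Const[of 1] vars_in_Const[of I 1] in \<open>auto simp: Const_one\<close>)
  have sum: "P (\<Sum>\<alpha>\<in>S. t \<alpha>) \<and> vars_in I (\<Sum>\<alpha>\<in>S. t \<alpha>)"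
    if "\<forall>\<alpha>\<in>S. P (t \<alpha>) \<and> vars_in I (t \<alpha>)" for S :: "(nat \<Rightarrow>\<^sub>0 nat) set" and t
    using that
  proof (induction S rule: infinite_finite_induct)
    case (insert \<alpha> S)
    then show ?case using add vars_in_add by simp
  qed (use Const[of 0] vars_in_zero in \<open>auto simp: Const_def\<close>)
  have "P (Poly_Mapping.single \<alpha> c) \<and> vars_in I (Poly_Mapping.single \<alpha> c)"
    if "Poly_Mapping.keys \<alpha> \<subseteq> I" for \<alpha> c
    unfolding single_eq_Const_Var
    using mult[OF vars_in_Const _ Const] vars_in_mult[OF vars_in_Const] prod[OF that] by auto
  moreover have "Poly_Mapping.keys \<alpha> \<subseteq> I" if "\<alpha> \<in> supp q" for \<alpha>
    using q that by (auto simp: vars_in_def)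
  ultimately have "P (\<Sum>\<alpha>\<in>supp q. Poly_Mapping.single \<alpha> (Poly_Mapping.lookup q \<alpha>))"
    by (intro sum[THEN conjunct1] ballI) simp
  then show ?thesis by (simp add: sum_single_lookup)
qed

text \<open>Tychonoff's theorem: points assign a value to every natural number, so even a problem in
  finitely many variables lives in an infinite product.\<close>

lemma compact_real_box: "compact {x::nat \<Rightarrow> real. \<forall>i. x i \<in> {- B i..B i}}"
proof -
  have "{x::nat \<Rightarrow> real. \<forall>i. x i \<in> {- B i..B i}} = (\<Pi>\<^sub>E i\<in>UNIV. {- B i..B i})"
    by (auto simp: PiE_def Pi_def)
  then show ?thesis
    using compactin_PiE[of "\<lambda>_::nat. euclidean :: real topology" UNIV "\<lambda>i. {- B i..B i}"]
    by (simp add: euclidean_product_topology)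
qed

section \<open>Archimedean quadratic modules\<close>

text \<open>Polynomials in \<open>I\<close> form a subset of one type, not a type of their own;
  hence the carrier \<open>A\<close>. The map \<open>C\<close> embeds the real scalars.\<close>

locale real_subalgebra =
  fixes C :: "real \<Rightarrow> 'a::comm_ring_1" and A :: "'a set"
  assumes C_add: "C (r + s) = C r + C s"
    and C_mult: "C (r * s) = C r * C s"
    and C_one: "C 1 = 1"
    and C_mem: "C r \<in> A"
    and add_mem: "a \<in> A \<Longrightarrow> b \<in> A \<Longrightarrow> a + b \<in> A"
    and mult_mem: "a \<in> A \<Longrightarrow> b \<in> A \<Longrightarrow> a * b \<in> A"
begin

lemma C_zero: "C 0 = 0"
  using C_add[of 0 0] by simp

lemma C_minus: "C (- r) = - C r"
  using C_add[of r "- r"] C_zero by (simp add: eq_neg_iff_add_eq_0 add.commute)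

lemma C_diff: "C (r - s) = C r - C s"
  using C_add[of r "- s"] C_minus by simp

lemma zero_mem: "0 \<in> A" and one_mem: "1 \<in> A"
  using C_mem[of 0] C_mem[of 1] C_zero C_one by auto

lemma uminus_mem: "a \<in> A \<Longrightarrow> - a \<in> A"
  using mult_mem[of "C (-1)" a] C_mem[of "-1"] by (simp add: C_minus C_one)

lemma diff_mem: "a \<in> A \<Longrightarrow> b \<in> A \<Longrightarrow> a - b \<in> A"
  using add_mem[of a "- b"] uminus_mem by simp

inductive_set sos :: "'a set" where
  sos_zero: "0 \<in> sos"
| sos_step: "a \<in> A \<Longrightarrow> s \<in> sos \<Longrightarrow> a * a + s \<in> sos"

lemma sos_mem: "s \<in> sos \<Longrightarrow> s \<in> A"
  by (induction rule: sos.induct) (auto intro: add_mem mult_mem zero_mem)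

lemma sos_add: "s \<in> sos \<Longrightarrow> t \<in> sos \<Longrightarrow> s + t \<in> sos"
  by (induction rule: sos.induct) (auto intro: sos_step simp: add.assoc)

lemma sos_square: "a \<in> A \<Longrightarrow> a * a \<in> sos"
  using sos_step[OF _ sos_zero] by simp

lemma sos_square_mult: "s \<in> sos \<Longrightarrow> a \<in> A \<Longrightarrow> a * a * s \<in> sos"
proof (induction rule: sos.induct)
  case (sos_step b s)
  have "a * a * (b * b + s) = (a * b) * (a * b) + a * a * s"
    by (simp add: algebra_simps)
  then show ?case using sos_step by (auto intro: sos.sos_step mult_mem)
qed (simp add: sos_zero)

text \<open>Properness is kept separate, since adjoining an element may destroy it, and the
  resulting representation of \<open>- 1\<close> is what the arguments exploit.\<close>

definition qmodule :: "'a set \<Rightarrow> bool" where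
  "qmodule M \<longleftrightarrow> M \<subseteq> A \<and> 1 \<in> M \<and> (\<forall>a\<in>M. \<forall>b\<in>M. a + b \<in> M) \<and> (\<forall>a\<in>A. \<forall>b\<in>M. a * a * b \<in> M)"

definition archimedean :: "'a set \<Rightarrow> bool" where
  "archimedean M \<longleftrightarrow> (\<forall>a\<in>A. \<exists>r. C r - a \<in> M)"

definition real_character :: "('a \<Rightarrow> real) \<Rightarrow> bool" where
  "real_character \<phi> \<longleftrightarrow> (\<forall>a\<in>A. \<forall>b\<in>A. \<phi> (a + b) = \<phi> a + \<phi> b \<and> \<phi> (a * b) = \<phi> a * \<phi> b)
     \<and> (\<forall>r. \<phi> (C r) = r)"

lemma
  assumes "qmodule M"
  shows qmodule_subset: "M \<subseteq> A"
    and qmodule_one: "1 \<in> M"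
    and qmodule_add: "a \<in> M \<Longrightarrow> b \<in> M \<Longrightarrow> a + b \<in> M"
    and qmodule_square_mult: "c \<in> A \<Longrightarrow> b \<in> M \<Longrightarrow> c * c * b \<in> M"
  using assms unfolding qmodule_def by auto

lemma qmodule_zero: "qmodule M \<Longrightarrow> 0 \<in> M"
  using qmodule_square_mult[of M 0 1] qmodule_one zero_mem by simp

lemma qmodule_sos_mult: "s \<in> sos \<Longrightarrow> qmodule M \<Longrightarrow> b \<in> M \<Longrightarrow> s * b \<in> M"
proof (induction s rule: sos.induct)
  case (sos_step a s)
  then show ?case
    using qmodule_square_mult[of M a b] qmodule_add[of M "a * a * b" "s * b"]
    by (simp add: algebra_simps)
qed (auto intro: qmodule_zero)

lemma qmodule_sos: "qmodule M \<Longrightarrow> s \<in> sos \<Longrightarrow> s \<in> M"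
  using qmodule_sos_mult[of s M 1] qmodule_one by simp

lemma qmodule_C: "qmodule M \<Longrightarrow> 0 \<le> r \<Longrightarrow> C r \<in> M"
  using qmodule_sos[OF _ sos_square[OF C_mem[of "sqrt r"]]] by (simp flip: C_mult)

lemma qmodule_C_mult:
  assumes "qmodule M" "0 \<le> r" "a \<in> M"
  shows "C r * a \<in> M"
  using qmodule_square_mult[OF assms(1) C_mem[of "sqrt r"] assms(3)] assms(2)
  by (simp flip: C_mult)

lemma qmodule_C_mult_cancel:
  assumes "qmodule M" "0 < r" "C r * a \<in> M"
  shows "a \<in> M"
  using qmodule_C_mult[OF assms(1) _ assms(3), of "1 / r"] assms(2)
  by (simp add: C_one flip: C_mult mult.assoc)

lemma C_numeral_2: "C 2 = 2" and C_numeral_4: "C 4 = 4"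
proof -
  show 2: "C 2 = 2" using C_add[of 1 1] C_one by simp
  show "C 4 = 4" using C_add[of 2 2] 2 by simp
qed

text \<open>Polarisation: a quadratic module admits only squares as multipliers, and this identity
  reduces an arbitrary multiplier to two squares.\<close>

lemma mult_diff_squares:
  "C 4 * (a * b) = (a + 1) * (a + 1) * b - (a - 1) * (a - 1) * b"
  unfolding C_numeral_4 by (simp add: algebra_simps)

text \<open>This is the quadratic module generated by \<open>M\<close> and \<open>a\<close>. Closure
  under multiplication by squares forces sums of squares, not just scalars, as coefficients of
  \<open>a\<close>.\<close>

lemma qmodule_adjoin:
  assumes M: "qmodule M" and a: "a \<in> A"
  shows "qmodule {m + s * a | m s. m \<in> M \<and> s \<in> sos}" (is "qmodule ?N")
    and "M \<subseteq> {m + s * a | m s. m \<in> M \<and> s \<in> sos}"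
    and "a \<in> {m + s * a | m s. m \<in> M \<and> s \<in> sos}"
proof -
  show sub: "M \<subseteq> ?N" using sos_zero by force
  show "a \<in> ?N"
    using qmodule_zero[OF M] sos_square[OF one_mem] by force
  show "qmodule ?N"
    unfolding qmodule_def
  proof (intro conjI ballI)
    show "?N \<subseteq> A"
      using qmodule_subset[OF M] a by (auto intro!: add_mem mult_mem intro: sos_mem)
    show "1 \<in> ?N" using sub qmodule_one[OF M] by blast
    fix x y assume "x \<in> ?N" "y \<in> ?N"
    then obtain m s m' s' where "x = m + s * a" "y = m' + s' * a"
      "m \<in> M" "s \<in> sos" "m' \<in> M" "s' \<in> sos" by blast
    moreover from this have "x + y = (m + m') + (s + s') * a" by (simp add: algebra_simps)
    ultimately show "x + y \<in> ?N" using qmodule_add[OF M] sos_add by blast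
  next
    fix c x assume c: "c \<in> A" and "x \<in> ?N"
    then obtain m s where "x = m + s * a" "m \<in> M" "s \<in> sos" by blast
    moreover from this have "c * c * x = c * c * m + (c * c * s) * a" by (simp add: algebra_simps)
    ultimately show "c * c * x \<in> ?N"
      using qmodule_square_mult[OF M c] sos_square_mult[OF _ c] by blast
  qed
qed

text \<open>If neither sign belonged to \<open>Q\<close>, maximality would give
  \<open>- 1 = q + s * a = q' - t * a\<close>. Eliminating \<open>a\<close> puts \<open>- s\<close>
  into \<open>Q\<close>. With both signs of \<open>s\<close> available, polarisation gives
  \<open>a * s \<in> Q\<close>, and then \<open>- 1 = q + s * a\<close> lies in
  \<open>Q\<close>.\<close>

lemma maximal_qmodule_total:
  assumes Q: "qmodule Q" and proper: "- 1 \<notin> Q"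
    and max: "\<And>Q'. qmodule Q' \<Longrightarrow> - 1 \<notin> Q' \<Longrightarrow> Q \<subseteq> Q' \<Longrightarrow> Q' = Q"
    and a: "a \<in> A"
  shows "a \<in> Q \<or> - a \<in> Q"
proof (rule ccontr)
  assume not: "\<not> (a \<in> Q \<or> - a \<in> Q)"
  have "\<exists>q\<in>Q. \<exists>s\<in>sos. - 1 = q + s * b" if "b \<in> A" "b \<notin> Q" for b
    using max[OF qmodule_adjoin(1)[OF Q that(1)] _ qmodule_adjoin(2)[OF Q that(1)]]
      qmodule_adjoin(3)[OF Q that(1)] that(2) by blast
  from this[OF a] this[OF uminus_mem[OF a]] not obtain q s q' t
    where q: "q \<in> Q" "s \<in> sos" "- 1 = q + s * a" and q': "q' \<in> Q" "t \<in> sos" "- 1 = q' + t * (- a)"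
    by blast
  have "- s - t = s * (- 1) + t * (- 1)" by simp
  also have "\<dots> = s * (q' + t * (- a)) + t * (q + s * a)" using q(3) q'(3) by simp
  also have "\<dots> = s * q' + t * q" by (simp add: algebra_simps)
  finally have "- s - t \<in> Q"
    using qmodule_add[OF Q qmodule_sos_mult[OF q(2) Q q'(1)] qmodule_sos_mult[OF q'(2) Q q(1)]] by simp
  then have "(- s - t) + t \<in> Q"
    using qmodule_add[OF Q _ qmodule_sos[OF Q q'(2)]] by blast
  then have ms: "- s \<in> Q" by simp
  have "C 4 * (a * s) = (a + 1) * (a + 1) * s + (a - 1) * (a - 1) * (- s)"
    using mult_diff_squares[of a s] by simp
  also have "\<dots> \<in> Q"
    using qmodule_add[OF Q qmodule_square_mult[OF Q add_mem[OF a one_mem] qmodule_sos[OF Q q(2)]]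
        qmodule_square_mult[OF Q diff_mem[OF a one_mem] ms]] .
  finally have "a * s \<in> Q" using qmodule_C_mult_cancel[OF Q, of 4] by simp
  then show False using q proper qmodule_add[OF Q, of q "a * s"] by (simp add: mult.commute)
qed

text \<open>The elements infinitesimal with respect to a maximal proper quadratic module form an
  ideal with residue field \<open>\<real>\<close>; the residue map is the character.\<close>

lemma maximal_qmodule_character:
  assumes Q: "qmodule Q" and arch: "archimedean Q" and proper: "- 1 \<notin> Q"
    and max: "\<And>Q'. qmodule Q' \<Longrightarrow> - 1 \<notin> Q' \<Longrightarrow> Q \<subseteq> Q' \<Longrightarrow> Q' = Q"
  shows "\<exists>\<phi>. real_character \<phi> \<and> (\<forall>q\<in>Q. 0 \<le> \<phi> q)"
proof -
  have C_nonneg: "0 \<le> r" if "C r \<in> Q" for r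
  proof (rule ccontr)
    assume "\<not> 0 \<le> r"
    with qmodule_C_mult[OF Q _ that, of "- 1 / r"] have "C (- 1) \<in> Q"
      by (simp flip: C_mult)
    with proper show False by (simp add: C_minus C_one)
  qed
  define I where "I = {a \<in> A. \<forall>e>0. C e + a \<in> Q \<and> C e - a \<in> Q}"
  have I_uminus: "- a \<in> I" if "a \<in> I" for a
    using that by (auto simp: I_def uminus_mem)
  have I_add: "a + b \<in> I" if "a \<in> I" "b \<in> I" for a b
    unfolding I_def
  proof (intro CollectI conjI allI impI)
    show "a + b \<in> A" using that by (auto simp: I_def intro: add_mem)
    fix e :: real assume "0 < e"
    then have "C (e/2) + a \<in> Q" "C (e/2) + b \<in> Q" "C (e/2) - a \<in> Q" "C (e/2) - b \<in> Q"
      using that by (auto simp: I_def)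
    then have "(C (e/2) + a) + (C (e/2) + b) \<in> Q" "(C (e/2) - a) + (C (e/2) - b) \<in> Q"
      using qmodule_add[OF Q] by blast+
    moreover have "C e = C (e/2) + C (e/2)" by (simp flip: C_add)
    ultimately show "C e + (a + b) \<in> Q" "C e - (a + b) \<in> Q"
      by (simp_all add: algebra_simps)
  qed
  have I_C_mult: "C r * a \<in> I" if "a \<in> I" "0 < r" for a r
    unfolding I_def
  proof (intro CollectI conjI allI impI)
    show "C r * a \<in> A" using that by (auto simp: I_def intro: mult_mem C_mem)
    fix e :: real assume "0 < e"
    then have "C (e / r) + a \<in> Q" "C (e / r) - a \<in> Q" using that by (auto simp: I_def)
    then have "C r * (C (e / r) + a) \<in> Q" "C r * (C (e / r) - a) \<in> Q"
      using qmodule_C_mult[OF Q, of r] that by auto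
    moreover have "C e = C r * C (e / r)" using that by (simp flip: C_mult)
    ultimately show "C e + C r * a \<in> Q" "C e - C r * a \<in> Q"
      by (simp_all add: algebra_simps)
  qed
  have I_square: "c * c * a \<in> I" if a: "a \<in> I" and c: "c \<in> A" for a c
  proof -
    obtain N0 where N0: "C N0 - c * c \<in> Q"
      using arch mult_mem[OF c c] unfolding archimedean_def by blast
    define N where "N = max N0 1"
    have "C N - c * c = C (N - N0) + (C N0 - c * c)" by (simp add: C_diff)
    then have N: "C N - c * c \<in> Q" "N > 0"
      using N0 qmodule_add[OF Q qmodule_C[OF Q, of "N - N0"] N0] by (auto simp: N_def add_diff_eq)
    \<comment> \<open>Modulo \<open>Q\<close>, the square \<open>c * c\<close> is at most
      \<open>N\<close>, so a tolerance \<open>e / N\<close> for \<open>a\<close> becomes a tolerance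
      \<open>e\<close> for \<open>c * c * a\<close>. The maximum with 1 above makes the division
      legitimate.\<close>
    have *: "C (e / N) * (C N - c * c) + c * c * (C (e / N) + b) = C e + c * c * b" for e b
      using \<open>N > 0\<close> C_mult[of "e/N" N] by (simp add: algebra_simps)
    show ?thesis
      unfolding I_def
    proof (intro CollectI conjI allI impI)
      show "c * c * a \<in> A" using a c by (auto simp: I_def intro: mult_mem)
      fix e :: real assume e: "0 < e"
      then have "C (e / N) + a \<in> Q" "C (e / N) + (- a) \<in> Q" using a N by (auto simp: I_def)
      then have "C (e / N) * (C N - c * c) + c * c * (C (e / N) + a) \<in> Q"
        "C (e / N) * (C N - c * c) + c * c * (C (e / N) + (- a)) \<in> Q"
        using qmodule_add[OF Q] qmodule_C_mult[OF Q _ N(1)] qmodule_square_mult[OF Q c] e N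
        by auto
      then show "C e + c * c * a \<in> Q" "C e - c * c * a \<in> Q"
        unfolding * by auto
    qed
  qed
  have I_mult: "b * a \<in> I" if "a \<in> I" "b \<in> A" for a b
  proof -
    have "C 4 * (b * a) = (b + 1) * (b + 1) * a + - ((b - 1) * (b - 1) * a)"
      using mult_diff_squares[of b a] by simp
    also have "\<dots> \<in> I"
      using that by (intro I_add I_uminus I_square add_mem diff_mem one_mem)
    finally have "C (1/4) * (C 4 * (b * a)) \<in> I" by (rule I_C_mult) simp
    moreover have "C (1/4) * C 4 = 1" by (simp add: C_one flip: C_mult)
    ultimately show ?thesis by (simp flip: mult.assoc)
  qed
  have I_C: "r = 0" if "C r \<in> I" for r
  proof -
    have "0 \<le> e + r \<and> 0 \<le> e - r" if "e > 0" for e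
      using \<open>C r \<in> I\<close> that C_nonneg[of "e + r"] C_nonneg[of "e - r"] by (simp add: I_def C_add C_diff)
    from this[of "\<bar>r\<bar> / 2"] show "r = 0" by linarith
  qed
  \<comment> \<open>A Dedekind cut: the residue of \<open>a\<close> is the infimum of its upper
    bounds modulo \<open>Q\<close>. Totality of \<open>Q\<close> turns "\<open>r - e\<close> is not
    an upper bound" into a lower bound for \<open>a\<close>.\<close>
  have ex: "\<exists>r. a - C r \<in> I" if a: "a \<in> A" for a
  proof -
    define S where "S = {r. C r - a \<in> Q}"
    obtain r0 where "C r0 - a \<in> Q" using arch a unfolding archimedean_def by blast
    then have ne: "S \<noteq> {}" by (auto simp: S_def)
    obtain r1 where r1: "C r1 - (- a) \<in> Q"
      using arch uminus_mem[OF a] unfolding archimedean_def by blast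
    have bdd: "bdd_below S"
    proof (rule bdd_belowI)
      fix r assume "r \<in> S"
      then have "(C r - a) + (C r1 - (- a)) \<in> Q"
        using qmodule_add[OF Q _ r1] unfolding S_def by blast
      then have "C (r + r1) \<in> Q" by (simp add: C_add)
      then show "- r1 \<le> r" using C_nonneg by fastforce
    qed
    define r where "r = Inf S"
    have "a - C r \<in> I"
      unfolding I_def
    proof (intro CollectI conjI allI impI)
      show "a - C r \<in> A" using a by (intro diff_mem C_mem)
      fix e :: real assume e: "0 < e"
      have "r - e \<notin> S" using cInf_lower[OF _ bdd, of "r - e"] e by (auto simp: r_def)
      moreover have "C (r - e) - a \<in> A" using a by (intro diff_mem C_mem)
      ultimately have "- (C (r - e) - a) \<in> Q"
        using maximal_qmodule_total[OF Q proper max] unfolding S_def by blast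
      then show "C e + (a - C r) \<in> Q" by (simp add: C_diff algebra_simps)
      obtain r' where r': "r' \<in> S" "r' < r + e"
        using cInf_lessD[OF ne, of "r + e"] e by (auto simp: r_def)
      have "C (r + e - r') + (C r' - a) \<in> Q"
        using r' by (intro qmodule_add[OF Q] qmodule_C[OF Q]) (auto simp: S_def)
      then show "C e - (a - C r) \<in> Q" by (simp add: C_diff C_add algebra_simps)
    qed
    then show ?thesis ..
  qed
  define \<phi> where "\<phi> a = (SOME r. a - C r \<in> I)" for a
  have \<phi>: "a - C (\<phi> a) \<in> I" if "a \<in> A" for a
    unfolding \<phi>_def using ex[OF that] by (rule someI_ex)
  have \<phi>_eq: "\<phi> a = r" if "a \<in> A" "a - C r \<in> I" for a r
  proof -
    have "(a - C r) + - (a - C (\<phi> a)) \<in> I" using that \<phi> by (intro I_add I_uminus)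
    then have "C (\<phi> a - r) \<in> I" by (simp add: C_diff)
    then show ?thesis using I_C by fastforce
  qed
  have "real_character \<phi>"
    unfolding real_character_def
  proof (intro conjI ballI allI)
    fix a b assume ab: "a \<in> A" "b \<in> A"
    have "(a - C (\<phi> a)) + (b - C (\<phi> b)) \<in> I" using ab \<phi> by (intro I_add)
    then show "\<phi> (a + b) = \<phi> a + \<phi> b"
      using ab by (intro \<phi>_eq add_mem) (simp_all add: C_add algebra_simps)
    have "b * (a - C (\<phi> a)) + C (\<phi> a) * (b - C (\<phi> b)) \<in> I"
      using ab \<phi> by (intro I_add I_mult C_mem)
    then show "\<phi> (a * b) = \<phi> a * \<phi> b"
      using ab by (intro \<phi>_eq mult_mem) (simp_all add: C_mult algebra_simps)
  next
    fix r show "\<phi> (C r) = r"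
      using qmodule_C[OF Q] by (intro \<phi>_eq C_mem) (auto simp: I_def zero_mem)
  qed
  moreover have "0 \<le> \<phi> q" if "q \<in> Q" for q
  proof (rule field_le_epsilon)
    fix e :: real assume "0 < e"
    then have "C e - (q - C (\<phi> q)) \<in> Q" using \<phi>[of q] that qmodule_subset[OF Q] by (auto simp: I_def)
    then have "(C e - (q - C (\<phi> q))) + q \<in> Q" using that by (rule qmodule_add[OF Q])
    then have "C (e + \<phi> q) \<in> Q" by (simp add: C_add)
    then show "0 \<le> \<phi> q + e" using C_nonneg by (simp add: add.commute)
  qed
  ultimately show ?thesis by blast
qed

text \<open>Zorn's lemma provides a maximal proper extension: the union of a chain omits
  \<open>- 1\<close> because every member does, and the archimedean property passes to larger
  modules.\<close>

lemma proper_qmodule_character: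
  assumes M: "qmodule M" and arch: "archimedean M" and proper: "- 1 \<notin> M"
  shows "\<exists>\<phi>. real_character \<phi> \<and> (\<forall>q\<in>M. 0 \<le> \<phi> q)"
proof -
  define \<Q> where "\<Q> = {Q. qmodule Q \<and> - 1 \<notin> Q \<and> M \<subseteq> Q}"
  have "\<exists>Q\<in>\<Q>. \<forall>X\<in>\<Q>. Q \<subseteq> X \<longrightarrow> X = Q"
  proof (rule subset_Zorn_nonempty)
    show "\<Q> \<noteq> {}" using assms by (auto simp: \<Q>_def)
    fix \<C> assume ne: "\<C> \<noteq> {}" and ch: "subset.chain \<Q> \<C>"
    have sub: "\<C> \<subseteq> \<Q>" and tot: "\<And>X Y. X \<in> \<C> \<Longrightarrow> Y \<in> \<C> \<Longrightarrow> X \<subseteq> Y \<or> Y \<subseteq> X"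
      using ch by (auto simp: subset_chain_def)
    have qm: "qmodule X" if "X \<in> \<C>" for X using sub that by (auto simp: \<Q>_def)
    have "qmodule (\<Union>\<C>)"
      unfolding qmodule_def
    proof (intro conjI ballI)
      show "\<Union>\<C> \<subseteq> A" using qm qmodule_subset by blast
      show "1 \<in> \<Union>\<C>" using qm qmodule_one ne by blast
      show "a + b \<in> \<Union>\<C>" if ab: "a \<in> \<Union>\<C>" "b \<in> \<Union>\<C>" for a b
      proof -
        obtain X Y where XY: "X \<in> \<C>" "a \<in> X" "Y \<in> \<C>" "b \<in> Y" using ab by blast
        then have "(a \<in> Y \<and> b \<in> Y) \<or> (a \<in> X \<and> b \<in> X)" using tot by blast
        then show ?thesis using qmodule_add[OF qm[OF XY(1)]] qmodule_add[OF qm[OF XY(3)]] XY by blast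
      qed
      show "a * a * b \<in> \<Union>\<C>" if "a \<in> A" "b \<in> \<Union>\<C>" for a b
        using that qm qmodule_square_mult by blast
    qed
    then show "\<Union>\<C> \<in> \<Q>" using sub ne by (auto simp: \<Q>_def)
  qed
  then obtain Q where Q: "qmodule Q" "- 1 \<notin> Q" "M \<subseteq> Q"
    and max: "\<And>X. X \<in> \<Q> \<Longrightarrow> Q \<subseteq> X \<Longrightarrow> X = Q" by (auto simp: \<Q>_def)
  have "archimedean Q" using arch Q unfolding archimedean_def by blast
  moreover have "Q' = Q" if "qmodule Q'" "- 1 \<notin> Q'" "Q \<subseteq> Q'" for Q'
    using max[of Q'] that Q by (auto simp: \<Q>_def)
  ultimately show ?thesis
    using maximal_qmodule_character[of Q] Q by blast
qed

text \<open>Adjoining \<open>- f\<close> to \<open>M\<close> leaves no character, which gives \<open>s f = 1 + m\<close>. The identity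
  \<open>k\<^sup>2 (f + r) - 1 = (k - s)\<^sup>2 (f + r) + 2 k m + (2 k - 1 - s\<^sup>2 f) + r s (2 k - s)\<close>
  then lowers a bound \<open>f + r \<in> M\<close> by the fixed amount \<open>1 / k\<^sup>2\<close>, until \<open>r\<close> is negative.\<close>

theorem archimedean_positivstellensatz:
  assumes M: "qmodule M" and arch: "archimedean M" and f: "f \<in> A"
    and pos: "\<And>\<phi>. real_character \<phi> \<Longrightarrow> (\<forall>q\<in>M. 0 \<le> \<phi> q) \<Longrightarrow> 0 < \<phi> f"
  shows "f \<in> M"
proof -
  let ?N = "{m + s * (- f) | m s. m \<in> M \<and> s \<in> sos}"
  note N = qmodule_adjoin[OF M uminus_mem[OF f]]
  have "- 1 \<in> ?N"
  proof (rule ccontr)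
    assume "- 1 \<notin> ?N"
    moreover have "archimedean ?N" using arch N(2) unfolding archimedean_def by blast
    ultimately obtain \<phi> where \<phi>: "real_character \<phi>" "\<forall>q\<in>?N. 0 \<le> \<phi> q"
      using proper_qmodule_character[OF N(1)] by blast
    then have "0 < \<phi> f" using pos[of \<phi>] N(2) by blast
    moreover have "0 \<le> \<phi> (- f)" using \<phi>(2) N(3) by blast
    moreover have "\<phi> (C 0) = \<phi> f + \<phi> (- f)"
      using \<phi>(1) f uminus_mem[OF f] unfolding real_character_def by (metis C_zero add.right_inverse)
    ultimately show False using \<phi>(1) unfolding real_character_def by fastforce
  qed
  then obtain m s where m: "m \<in> M" and s: "s \<in> sos" and eq: "- 1 = m + s * (- f)" by blast
  have sf: "s * f = 1 + m" using eq by (simp add: algebra_simps eq_neg_iff_add_eq_0)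
  obtain a where a: "C a - s \<in> M" using arch sos_mem[OF s] unfolding archimedean_def by blast
  obtain b where b: "C b - s * s * f \<in> M"
    using arch sos_mem[OF s] f mult_mem unfolding archimedean_def by blast
  \<comment> \<open>The last two entries put \<open>2 k - s\<close> and
    \<open>2 k - 1 - s * s * f\<close> into \<open>M\<close>; the entry 1 makes \<open>k\<close>
    invertible.\<close>
  define k where "k = max 1 (max (a/2) ((b + 1)/2))"
  have "k \<ge> 1" "k \<ge> a/2" "k \<ge> (b + 1)/2" unfolding k_def by (intro max.coboundedI1 max.coboundedI2 order.refl)+
  then have k: "k \<ge> 1" "2 * k \<ge> a" "2 * k - 1 \<ge> b" by auto
  have k1: "C (2 * k) - s \<in> M"
    using qmodule_add[OF M qmodule_C[OF M, of "2 * k - a"] a] k by (simp add: C_diff add_diff_eq)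
  have k2: "C (2 * k - 1) - s * s * f \<in> M"
    using qmodule_add[OF M qmodule_C[OF M, of "2 * k - 1 - b"] b] k by (simp add: C_diff add_diff_eq)
  define d where "d = 1 / k\<^sup>2"
  have d: "d > 0" "k * k * d = 1" using k by (auto simp: d_def power2_eq_square)
  have step: "f + C (r - d) \<in> M" if r: "f + C r \<in> M" "0 \<le> r" for r
  proof -
    have "(C k - s) * (C k - s) * (f + C r) + (C (2 * k) * m + ((C (2 * k - 1) - s * s * f)
        + C r * (s * (C (2 * k) - s)))) \<in> M" (is "?x \<in> M")
    proof (rule qmodule_add[OF M])
      show "(C k - s) * (C k - s) * (f + C r) \<in> M"
        using r s by (intro qmodule_square_mult[OF M] diff_mem C_mem sos_mem)
      have "C (2 * k) * m \<in> M" using qmodule_C_mult[OF M _ m, of "2 * k"] k by simp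
      moreover have "C r * (s * (C (2 * k) - s)) \<in> M"
        using qmodule_C_mult[OF M r(2) qmodule_sos_mult[OF s M k1]] .
      ultimately show "C (2 * k) * m + ((C (2 * k - 1) - s * s * f) + C r * (s * (C (2 * k) - s))) \<in> M"
        using k2 qmodule_add[OF M] by blast
    qed
    also have "?x = C k * C k * (f + C r) - 1"
    proof -
      have m_eq: "m = s * f - 1" using sf by simp
      have "C (2 * k) = 2 * C k" by (simp add: C_mult C_numeral_2)
      then show ?thesis unfolding m_eq C_diff C_one by (simp add: algebra_simps)
    qed
    also have "\<dots> = C (k * k) * (f + C (r - d))"
    proof -
      have "C (k * k) * C d = 1" using d(2) C_one by (simp flip: C_mult)
      then show ?thesis by (simp add: C_diff C_mult algebra_simps)
    qed
    finally show ?thesis using qmodule_C_mult_cancel[OF M, of "k * k"] k by simp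
  qed
  obtain r0 where "C r0 - (- f) \<in> M" using arch uminus_mem[OF f] unfolding archimedean_def by blast
  then have r0: "f + C r0 \<in> M" by (simp add: add.commute)
  \<comment> \<open>The maximum with 0 reflects that a step is possible only while \<open>r\<close>
    is nonnegative. Once \<open>n * d\<close> exceeds \<open>r0\<close> the bound is 0, and adding
    the nonnegative constant \<open>- r\<close> leaves \<open>f\<close>.\<close>
  have "\<exists>r. f + C r \<in> M \<and> r \<le> max 0 (r0 - real n * d)" for n
  proof (induction n)
    case 0 then show ?case using r0 by (intro exI[of _ r0]) auto
  next
    case (Suc n)
    then obtain r where r: "f + C r \<in> M" "r \<le> max 0 (r0 - real n * d)" by blast
    show ?case
    proof (cases "0 \<le> r")
      case True
      show ?thesis
        using step[OF r(1) True] r(2) d(1)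
        by (intro exI[of _ "r - d"]) (auto simp: algebra_simps max_def split: if_splits)
    next
      case False
      then show ?thesis using r by (intro exI[of _ r]) auto
    qed
  qed
  moreover obtain n where "r0 < real n * d" using reals_Archimedean3[OF d(1)] by blast
  ultimately obtain r where r: "f + C r \<in> M" "r \<le> max 0 (r0 - real n * d)" by blast
  then have "(f + C r) + C (- r) \<in> M"
    using \<open>r0 < real n * d\<close> qmodule_add[OF M _ qmodule_C[OF M, of "- r"]] by simp
  then show ?thesis by (simp add: C_minus)
qed

section \<open>The subalgebra of bounded elements, which reduces the archimedean property to the
  variables\<close>

definition bounded_elements :: "'a set \<Rightarrow> 'a set" where
  "bounded_elements M = {a \<in> A. \<exists>r>0. C r - a \<in> M \<and> C r + a \<in> M}"

lemma bounded_elements_C: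
  assumes M: "qmodule M" shows "C c \<in> bounded_elements M"
  unfolding bounded_elements_def
  using qmodule_C[OF M] by (auto intro!: C_mem exI[of _ "\<bar>c\<bar> + 1"] simp flip: C_add C_diff)

lemma bounded_elements_add:
  assumes M: "qmodule M" and "a \<in> bounded_elements M" "b \<in> bounded_elements M"
  shows "a + b \<in> bounded_elements M"
proof -
  obtain r s where rs: "r > 0" "C r - a \<in> M" "C r + a \<in> M" "s > 0" "C s - b \<in> M" "C s + b \<in> M"
    and ab: "a \<in> A" "b \<in> A"
    using assms unfolding bounded_elements_def by auto
  have "(C r - a) + (C s - b) \<in> M" "(C r + a) + (C s + b) \<in> M"
    using rs qmodule_add[OF M] by auto
  then show ?thesis
    unfolding bounded_elements_def
    using rs ab by (auto intro!: add_mem exI[of _ "r + s"] simp: C_add algebra_simps)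
qed

lemma bounded_elements_C_mult:
  assumes M: "qmodule M" and "a \<in> bounded_elements M"
  shows "C c * a \<in> bounded_elements M"
proof (cases "c = 0")
  case True
  then show ?thesis using bounded_elements_C[OF M, of 0] by (simp add: C_zero)
next
  case False
  obtain r where r: "r > 0" "C r - a \<in> M" "C r + a \<in> M" and a: "a \<in> A"
    using assms unfolding bounded_elements_def by auto
  have "C \<bar>c\<bar> * (C r - a) \<in> M" "C \<bar>c\<bar> * (C r + a) \<in> M"
    using r qmodule_C_mult[OF M] by auto
  moreover have "C \<bar>c\<bar> = C c \<or> C \<bar>c\<bar> = - C c" by (auto simp: abs_if C_minus)
  then have "C \<bar>c\<bar> * a = C c * a \<or> C \<bar>c\<bar> * a = - (C c * a)" by auto
  ultimately have "C (\<bar>c\<bar> * r) - C c * a \<in> M \<and> C (\<bar>c\<bar> * r) + C c * a \<in> M"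
    by (auto simp: C_mult ring_distribs)
  then show ?thesis
    unfolding bounded_elements_def
    using r a False by (auto intro!: mult_mem C_mem exI[of _ "\<bar>c\<bar> * r"])
qed

text \<open>Closure of the bounded elements under squares rests on
  \<open>2 r (r\<^sup>2 - a\<^sup>2) = (r + a)\<^sup>2 (r - a) + (r - a)\<^sup>2 (r + a)\<close>.\<close>

lemma bounded_elements_square:
  assumes M: "qmodule M" and "a \<in> bounded_elements M"
  shows "a * a \<in> bounded_elements M"
proof -
  obtain r where r: "r > 0" "C r - a \<in> M" "C r + a \<in> M" and a: "a \<in> A"
    using assms unfolding bounded_elements_def by auto
  have "(C r + a) * (C r + a) * (C r - a) + (C r - a) * (C r - a) * (C r + a) \<in> M"
    by (rule qmodule_add[OF M qmodule_square_mult[OF M add_mem[OF C_mem a] r(2)]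
          qmodule_square_mult[OF M diff_mem[OF C_mem a] r(3)]])
  also have "(C r + a) * (C r + a) * (C r - a) + (C r - a) * (C r - a) * (C r + a)
      = C (2 * r) * (C (r * r) - a * a)"
    by (simp add: C_mult C_numeral_2 algebra_simps)
  finally have "C (r * r) - a * a \<in> M" using qmodule_C_mult_cancel[OF M, of "2 * r"] r by simp
  moreover have "C (r * r) + a * a \<in> M"
    using a by (intro qmodule_add[OF M] qmodule_C[OF M] qmodule_sos[OF M] sos_square) auto
  ultimately show ?thesis
    unfolding bounded_elements_def using r a by (auto intro!: mult_mem exI[of _ "r * r"])
qed

text \<open>From squares by \<open>4 a b = (a + b)^2 - (a - b)^2\<close>; differences are written
  with the scalar \<open>C (-1)\<close> so that closure under sums and constant multiples applies
  directly.\<close>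

lemma bounded_elements_mult:
  assumes M: "qmodule M" and "a \<in> bounded_elements M" "b \<in> bounded_elements M"
  shows "a * b \<in> bounded_elements M"
proof -
  have "C (1/4) * ((a + b) * (a + b) + C (-1) * ((a + C (-1) * b) * (a + C (-1) * b))) \<in> bounded_elements M"
    using assms by (intro bounded_elements_C_mult bounded_elements_add bounded_elements_square)
  also have "C (1/4) * ((a + b) * (a + b) + C (-1) * ((a + C (-1) * b) * (a + C (-1) * b)))
      = C (1/4) * C 4 * (a * b)"
    by (simp add: C_minus C_one C_numeral_4 algebra_simps)
  also have "\<dots> = a * b" by (simp add: C_one flip: C_mult)
  finally show ?thesis .
qed

text \<open>The identity \<open>(c + 1)^2 + (r' - c^2) = r' + 1 + 2 c\<close>, used for
  \<open>c = a\<close> and \<open>c = - a\<close>, bounds \<open>a\<close> from both sides by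
  \<open>(r' + 1)/2\<close>. Passing from \<open>r\<close> to \<open>r' = max r 0\<close> makes this
  bound positive.\<close>

lemma bounded_elements_squareD:
  assumes M: "qmodule M" and a: "a \<in> A" and r: "C r - a * a \<in> M"
  shows "a \<in> bounded_elements M"
proof -
  define r' where "r' = max r 0"
  have r': "C r' - a * a \<in> M"
    using qmodule_add[OF M qmodule_C[OF M, of "r' - r"] r] by (simp add: C_diff r'_def)
  have double: "C 2 * (C ((r' + 1)/2) + c) \<in> M" if "c \<in> A" "c * c = a * a" for c
  proof -
    have "(c + 1) * (c + 1) + (C r' - a * a) \<in> M"
      using qmodule_add[OF M qmodule_sos[OF M sos_square] r'] add_mem[OF that(1) one_mem] by blast
    moreover have "(c + 1) * (c + 1) + (C r' - a * a) = C (r' + 1) + 2 * c"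
      unfolding that(2)[symmetric] by (simp add: C_add C_one algebra_simps)
    moreover have "C (r' + 1) = C 2 * C ((r' + 1)/2)" unfolding C_mult[symmetric] by (intro arg_cong[of _ _ C]) simp
    ultimately show ?thesis by (simp only: C_numeral_2 distrib_left)
  qed
  have "C ((r' + 1)/2) + c \<in> M" if "c \<in> A" "c * c = a * a" for c
    by (rule qmodule_C_mult_cancel[OF M _ double[OF that]]) simp
  from this[OF a] this[OF uminus_mem[OF a]] have "C ((r' + 1)/2) - a \<in> M" "C ((r' + 1)/2) + a \<in> M"
    by simp_all
  moreover have "0 < (r' + 1)/2" by (simp add: r'_def)
  ultimately show ?thesis
    unfolding bounded_elements_def using a by blast
qed

end

section \<open>Putinar representations and parity\<close>

interpretation poly: real_subalgebra Const "{q. vars_in I q}" for I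
  by unfold_locales
    (auto simp: Const_add Const_mult Const_one vars_in_Const vars_in_add vars_in_mult)

lemma sos_in_iff: "sos_in I \<sigma> \<longleftrightarrow> \<sigma> \<in> poly.sos I"
proof
  assume "sos_in I \<sigma>"
  then obtain qs where "\<forall>q\<in>set qs. vars_in I q" "\<sigma> = sum_list (map (\<lambda>q. q * q) qs)"
    unfolding sos_in_def by blast
  then show "\<sigma> \<in> poly.sos I"
    by (induction qs arbitrary: \<sigma>) (auto intro: poly.sos.intros)
next
  assume "\<sigma> \<in> poly.sos I"
  then show "sos_in I \<sigma>"
  proof (induction rule: poly.sos.induct)
    case sos_zero
    then show ?case unfolding sos_in_def by (intro exI[of _ "[]"]) simp
  next
    case (sos_step a s)
    then obtain qs where "\<forall>q\<in>set qs. vars_in I q" "s = sum_list (map (\<lambda>q. q * q) qs)"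
      unfolding sos_in_def by blast
    then show ?case using sos_step unfolding sos_in_def by (intro exI[of _ "a # qs"]) auto
  qed
qed

text \<open>A homomorphism fixing the scalars is determined by its values on the variables.
  Characters are thus real points, and pointwise positivity becomes positivity under
  characters.\<close>

lemma character_eq_eval:
  assumes \<phi>: "poly.real_character I \<phi>" and q: "vars_in I q"
  shows "\<phi> q = eval q (\<lambda>i. \<phi> (Var i))"
  using q \<phi>
  by (induction rule: vars_in_induct)
    (auto simp: poly.real_character_def eval_Const eval_Var eval_add eval_mult)

text \<open>\<open>M\<close> is the quadratic module generated by the \<open>g j\<close>. A
  character nonnegative on \<open>M\<close> is evaluation at a feasible point, where
  \<open>h\<close> is positive by hypothesis.\<close>

lemma putinar_positivstellensatz:
  assumes fin: "finite I" "finite J"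
    and g: "\<forall>j\<in>J. vars_in I (g j)"
    and ball: "\<exists>j\<in>J. g j = Const N - (\<Sum>i\<in>I. Var i * Var i)"
    and h: "vars_in I h"
    and pos: "\<And>x. (\<forall>j\<in>J. 0 \<le> eval (g j) x) \<Longrightarrow> 0 < eval h x"
  shows "\<exists>\<sigma>0 \<sigma>. h = \<sigma>0 + (\<Sum>j\<in>J. \<sigma> j * g j) \<and> sos_in I \<sigma>0 \<and> (\<forall>j\<in>J. sos_in I (\<sigma> j))"
proof -
  define M where "M = {\<sigma>0 + (\<Sum>j\<in>J. \<sigma> j * g j) | \<sigma>0 \<sigma>. \<sigma>0 \<in> poly.sos I \<and> (\<forall>j\<in>J. \<sigma> j \<in> poly.sos I)}"
  have MI: "\<sigma>0 + (\<Sum>j\<in>J. \<sigma> j * g j) \<in> M" if "\<sigma>0 \<in> poly.sos I" "\<forall>j\<in>J. \<sigma> j \<in> poly.sos I" for \<sigma>0 \<sigma>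
    using that unfolding M_def by blast
  have sos_M: "s \<in> M" if "s \<in> poly.sos I" for s
    using MI[OF that, of "\<lambda>_. 0"] poly.sos.sos_zero by simp
  have one_sos: "1 \<in> poly.sos I" using poly.sos_square[OF poly.one_mem] by simp
  have g_M: "g j \<in> M" if "j \<in> J" for j
  proof -
    have "0 + (\<Sum>j'\<in>J. (if j' = j then 1 else 0) * g j') \<in> M"
      using one_sos by (intro MI) (auto intro: poly.sos.sos_zero)
    moreover have "(\<Sum>j'\<in>J. (if j' = j then 1 else 0) * g j') = g j"
      using fin that by (simp add: if_distrib[of "\<lambda>c. c * _"] cong: if_cong)
    ultimately show ?thesis by simp
  qed
  have M: "poly.qmodule I M"
    unfolding poly.qmodule_def
  proof (intro conjI ballI)
    show "M \<subseteq> {q. vars_in I q}"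
      using g poly.sos_mem by (fastforce simp: M_def intro!: vars_in_add vars_in_sum vars_in_mult)
    show "1 \<in> M" by (rule sos_M[OF one_sos])
    fix a b assume "a \<in> M" "b \<in> M"
    then obtain s \<sigma> t \<tau> where "a = s + (\<Sum>j\<in>J. \<sigma> j * g j)" "b = t + (\<Sum>j\<in>J. \<tau> j * g j)"
      and st: "s \<in> poly.sos I" "t \<in> poly.sos I" "\<forall>j\<in>J. \<sigma> j \<in> poly.sos I" "\<forall>j\<in>J. \<tau> j \<in> poly.sos I"
      unfolding M_def by blast
    then have "a + b = (s + t) + (\<Sum>j\<in>J. (\<sigma> j + \<tau> j) * g j)"
      by (simp add: distrib_right sum.distrib)
    also have "\<dots> \<in> M" using st by (intro MI) (auto intro: poly.sos_add)
    finally show "a + b \<in> M" .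
  next
    fix a b assume a: "a \<in> {q. vars_in I q}" and "b \<in> M"
    then obtain s \<sigma> where "b = s + (\<Sum>j\<in>J. \<sigma> j * g j)"
      and s: "s \<in> poly.sos I" "\<forall>j\<in>J. \<sigma> j \<in> poly.sos I"
      unfolding M_def by blast
    then have "a * a * b = a * a * s + (\<Sum>j\<in>J. (a * a * \<sigma> j) * g j)"
      by (simp add: distrib_left sum_distrib_left mult.assoc)
    also have "\<dots> \<in> M" using s poly.sos_square_mult[OF _ a] by (intro MI) auto
    finally show "a * a * b \<in> M" .
  qed
  have "q \<in> poly.bounded_elements I M" if "vars_in I q" for q
    using that
  proof (induction rule: vars_in_induct)
    case (Var i)
    from ball obtain j where j: "j \<in> J" "g j = Const N - (\<Sum>i\<in>I. Var i * Var i)" by blast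
    have "(\<Sum>i\<in>S. Var i * Var i) \<in> poly.sos I" if "S \<subseteq> I" for S
      using that by (induction S rule: infinite_finite_induct)
        (auto intro: poly.sos.intros simp: vars_in_Var)
    \<comment> \<open>Adding the squares of the other variables to the ball constraint leaves
      \<open>N\<close> minus the square of the single variable \<open>Var i\<close>, which bounds
      that variable.\<close>
    from sos_M[OF this[of "I - {i}"]]
    have "g j + (\<Sum>i\<in>I - {i}. Var i * Var i) \<in> M" by (intro poly.qmodule_add[OF M] g_M[OF j(1)]) auto
    then have "Const N - Var i * Var i \<in> M"
      using fin(1) Var by (simp add: j(2) sum.remove[of I i])
    then show ?case
      using Var by (intro poly.bounded_elements_squareD[OF M]) (auto simp: vars_in_Var)
  qed (auto intro: poly.bounded_elements_C[OF M] poly.bounded_elements_add[OF M]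
      poly.bounded_elements_mult[OF M])
  then have "poly.archimedean I M"
    unfolding poly.archimedean_def poly.bounded_elements_def by blast
  then have "h \<in> M"
  proof (rule poly.archimedean_positivstellensatz[OF M])
    fix \<phi> assume \<phi>: "poly.real_character I \<phi>" "\<forall>q\<in>M. 0 \<le> \<phi> q"
    have "0 < eval h (\<lambda>i. \<phi> (Var i))"
      using \<phi>(2) g_M g by (intro pos) (simp flip: character_eq_eval[OF \<phi>(1)])
    then show "0 < \<phi> h" by (simp add: character_eq_eval[OF \<phi>(1) h])
  qed (use h in simp)
  then show ?thesis unfolding M_def sos_in_iff by blast
qed

section \<open>Projections onto sets of monomials and the grading by parity\<close>

definition restrict_supp :: "((nat \<Rightarrow>\<^sub>0 nat) \<Rightarrow> bool) \<Rightarrow> mpoly \<Rightarrow> mpoly" where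
  "restrict_supp P q = (\<Sum>\<alpha>\<in>supp q. if P \<alpha> then Poly_Mapping.single \<alpha> (Poly_Mapping.lookup q \<alpha>) else 0)"

lemma lookup_restrict_supp:
  "Poly_Mapping.lookup (restrict_supp P q) \<alpha> = (if P \<alpha> then Poly_Mapping.lookup q \<alpha> else 0)"
proof -
  have "Poly_Mapping.lookup (restrict_supp P q) \<alpha>
      = (\<Sum>\<beta>\<in>supp q. if \<beta> = \<alpha> then (if P \<alpha> then Poly_Mapping.lookup q \<alpha> else 0) else 0)"
    unfolding restrict_supp_def lookup_sum by (intro sum.cong) (auto simp: lookup_single when_def)
  then show ?thesis by (auto simp: in_keys_iff)
qed

lemma supp_restrict_supp: "supp (restrict_supp P q) = {\<alpha> \<in> supp q. P \<alpha>}"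
  by (auto simp: in_keys_iff lookup_restrict_supp split: if_splits)

lemma restrict_supp_add: "restrict_supp P (q + r) = restrict_supp P q + restrict_supp P r"
  by (rule poly_mapping_eqI) (simp add: lookup_restrict_supp lookup_add)

lemma restrict_supp_zero: "restrict_supp P 0 = 0"
  by (rule poly_mapping_eqI) (simp add: lookup_restrict_supp)

lemma restrict_supp_sum: "restrict_supp P (\<Sum>a\<in>S. q a) = (\<Sum>a\<in>S. restrict_supp P (q a))"
  by (induction S rule: infinite_finite_induct) (auto simp: restrict_supp_add restrict_supp_zero)

lemma restrict_supp_id: "(\<And>\<alpha>. \<alpha> \<in> supp q \<Longrightarrow> P \<alpha>) \<Longrightarrow> restrict_supp P q = q"
  by (rule poly_mapping_eqI) (auto simp: lookup_restrict_supp in_keys_iff)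

lemma restrict_supp_none: "(\<And>\<alpha>. \<alpha> \<in> supp q \<Longrightarrow> \<not> P \<alpha>) \<Longrightarrow> restrict_supp P q = 0"
  by (rule poly_mapping_eqI) (auto simp: lookup_restrict_supp in_keys_iff)

lemma vars_in_restrict_supp: "vars_in I q \<Longrightarrow> vars_in I (restrict_supp P q)"
  by (auto simp: vars_in_def supp_restrict_supp)

text \<open>The vector of parities of \<alpha> under all symmetries, encoded as the set where it
  equals 1. It is the degree of \<alpha> in a grading by subsets of \<open>\<S>\<close> under
  symmetric difference; the even monomials have degree \<open>{}\<close>.\<close>

definition parity_class :: "nat set set \<Rightarrow> (nat \<Rightarrow>\<^sub>0 nat) \<Rightarrow> nat set set" where
  "parity_class \<S> \<alpha> = {S \<in> \<S>. odd (sdot S \<alpha>)}"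

lemma parity_class_add_eq_empty: "parity_class \<S> (\<alpha> + \<beta>) = {} \<longleftrightarrow> parity_class \<S> \<alpha> = parity_class \<S> \<beta>"
proof -
  have "sdot S (\<alpha> + \<beta>) = sdot S \<alpha> + sdot S \<beta>" for S
    by (simp add: sdot_def lookup_add sum.distrib)
  then show ?thesis by (auto simp: parity_class_def set_eq_iff)
qed

abbreviation even_part :: "nat set set \<Rightarrow> mpoly \<Rightarrow> mpoly" where
  "even_part \<S> \<equiv> restrict_supp (\<lambda>\<alpha>. parity_class \<S> \<alpha> = {})"

lemma even_part_mult_class:
  assumes "\<And>\<alpha>. \<alpha> \<in> supp q \<Longrightarrow> parity_class \<S> \<alpha> = c" "\<And>\<alpha>. \<alpha> \<in> supp r \<Longrightarrow> parity_class \<S> \<alpha> = d"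
  shows "even_part \<S> (q * r) = (if c = d then q * r else 0)"
proof -
  have "parity_class \<S> \<gamma> = {} \<longleftrightarrow> c = d" if \<gamma>: "\<gamma> \<in> supp (q * r)" for \<gamma>
  proof -
    obtain \<alpha> \<beta> where "\<gamma> = \<alpha> + \<beta>" "\<alpha> \<in> supp q" "\<beta> \<in> supp r"
      using keys_mult[of q r] \<gamma> by blast
    then show ?thesis using assms parity_class_add_eq_empty by simp
  qed
  then show ?thesis by (auto intro: restrict_supp_id restrict_supp_none)
qed

lemma sum_parity_classes:
  "(\<Sum>c\<in>parity_class \<S> ` supp q. restrict_supp (\<lambda>\<alpha>. parity_class \<S> \<alpha> = c) q) = q"
proof (rule poly_mapping_eqI)
  fix \<alpha>
  have "Poly_Mapping.lookup (\<Sum>c\<in>parity_class \<S> ` supp q. restrict_supp (\<lambda>\<alpha>. parity_class \<S> \<alpha> = c) q) \<alpha>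
    = (if parity_class \<S> \<alpha> \<in> parity_class \<S> ` supp q then Poly_Mapping.lookup q \<alpha> else 0)"
    by (simp add: lookup_sum lookup_restrict_supp)
  also have "\<dots> = Poly_Mapping.lookup q \<alpha>" by (auto simp: in_keys_iff)
  finally show "Poly_Mapping.lookup (\<Sum>c\<in>parity_class \<S> ` supp q.
      restrict_supp (\<lambda>\<alpha>. parity_class \<S> \<alpha> = c) q) \<alpha> = Poly_Mapping.lookup q \<alpha>" .
qed

text \<open>Multiplication by a \<open>g\<close> of degree \<open>{}\<close> preserves every parity
  component, so the projection is linear over even polynomials.\<close>

lemma even_part_mult:
  assumes g: "\<And>\<alpha>. \<alpha> \<in> supp g \<Longrightarrow> parity_class \<S> \<alpha> = {}"
  shows "even_part \<S> (q * g) = even_part \<S> q * g"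
proof -
  let ?q = "\<lambda>c. restrict_supp (\<lambda>\<alpha>. parity_class \<S> \<alpha> = c) q"
  let ?C = "parity_class \<S> ` supp q"
  have "even_part \<S> (?q c * g) = (if c = {} then ?q c * g else 0)" for c
    using g by (intro even_part_mult_class) (auto simp: supp_restrict_supp)
  moreover have "q * g = (\<Sum>c\<in>?C. ?q c * g)"
    by (simp only: sum_parity_classes flip: sum_distrib_right)
  ultimately have "even_part \<S> (q * g) = (\<Sum>c\<in>?C. if c = {} then ?q c * g else 0)"
    by (simp add: restrict_supp_sum)
  also have "\<dots> = (if {} \<in> ?C then ?q {} * g else 0)" by simp
  also have "\<dots> = ?q {} * g"
    using restrict_supp_none[of q "\<lambda>\<alpha>. parity_class \<S> \<alpha> = {}"] by (auto simp: image_iff)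
  finally show ?thesis .
qed

text \<open>Components of distinct classes multiply to polynomials without even monomials, so the
  projection kills all cross terms, while each component squared is entirely even.\<close>

lemma even_part_square:
  "even_part \<S> (q * q) = (\<Sum>c\<in>parity_class \<S> ` supp q.
     restrict_supp (\<lambda>\<alpha>. parity_class \<S> \<alpha> = c) q * restrict_supp (\<lambda>\<alpha>. parity_class \<S> \<alpha> = c) q)"
proof -
  let ?q = "\<lambda>c. restrict_supp (\<lambda>\<alpha>. parity_class \<S> \<alpha> = c) q"
  let ?C = "parity_class \<S> ` supp q"
  have "q * q = (\<Sum>c\<in>?C. ?q c) * (\<Sum>d\<in>?C. ?q d)" by (simp only: sum_parity_classes)
  also have "\<dots> = (\<Sum>c\<in>?C. \<Sum>d\<in>?C. ?q c * ?q d)" by (simp only: sum_product)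
  finally have "even_part \<S> (q * q) = (\<Sum>c\<in>?C. \<Sum>d\<in>?C. even_part \<S> (?q c * ?q d))"
    by (simp only: restrict_supp_sum)
  also have "\<dots> = (\<Sum>c\<in>?C. \<Sum>d\<in>?C. if c = d then ?q c * ?q d else 0)"
    by (intro sum.cong refl even_part_mult_class) (auto simp: supp_restrict_supp)
  also have "\<dots> = (\<Sum>c\<in>?C. ?q c * ?q c)" by (intro sum.cong refl) simp
  finally show ?thesis .
qed

lemma sos_in_even_part:
  assumes "sos_in I \<sigma>"
  shows "sos_in I (even_part \<S> \<sigma>)"
proof -
  from assms have "\<sigma> \<in> poly.sos I" by (simp add: sos_in_iff)
  then have "even_part \<S> \<sigma> \<in> poly.sos I"
  proof (induction rule: poly.sos.induct)
    case (sos_step a s)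
    have "(\<Sum>c\<in>S. t c * t c) \<in> poly.sos I" if "\<And>c. vars_in I (t c)"
      for S and t :: "nat set set \<Rightarrow> mpoly"
      using that by (induction S rule: infinite_finite_induct) (auto intro: poly.sos.intros)
    then have "even_part \<S> (a * a) \<in> poly.sos I"
      using sos_step(1) unfolding even_part_square by (simp add: vars_in_restrict_supp)
    then show ?case using sos_step(3) by (simp only: restrict_supp_add poly.sos_add)
  qed (simp add: restrict_supp_zero poly.sos.sos_zero)
  then show ?thesis by (simp add: sos_in_iff)
qed

section \<open>Sparse decomposition\<close>

definition feasible :: "mpoly set \<Rightarrow> (nat \<Rightarrow> real) set" where
  "feasible G = {x. \<forall>g\<in>G. 0 \<le> eval g x}"

text \<open>Boundedness of coordinates is required instead of an explicit ball polynomial because it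
  passes to unions of blocks, whose constraints need not contain a ball polynomial in all their
  variables.\<close>

definition ball_constrained :: "nat set \<Rightarrow> mpoly set \<Rightarrow> bool" where
  "ball_constrained I G \<longleftrightarrow> finite I \<and> (\<forall>g\<in>G. vars_in I g)
     \<and> (\<forall>i\<in>I. \<exists>B. \<forall>x\<in>feasible G. \<bar>x i\<bar> \<le> B)"

lemma feasible_cong:
  assumes "\<forall>g\<in>G. vars_in I g" "\<And>i. i \<in> I \<Longrightarrow> x i = y i" "x \<in> feasible G"
  shows "y \<in> feasible G"
  using assms(3) eval_cong[of I _ x y] assms(1,2) by (fastforce simp: feasible_def)

text \<open>Coordinates outside \<open>I\<close> are set to \<open>0\<close>; otherwise the feasible set is an unbounded cylinder.\<close>

lemma compact_feasible:
  assumes "ball_constrained I G"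
  shows "compact {x \<in> feasible G. \<forall>i. i \<notin> I \<longrightarrow> x i = 0}" (is "compact ?K")
proof -
  obtain B where B: "\<And>i x. i \<in> I \<Longrightarrow> x \<in> feasible G \<Longrightarrow> \<bar>x i\<bar> \<le> B i"
    using assms unfolding ball_constrained_def by metis
  define B' where "B' i = (if i \<in> I then B i else 0)" for i
  have cont: "continuous_on UNIV (\<lambda>x::nat \<Rightarrow> real. x i)" for i by simp
  have "?K = (\<Inter>g\<in>G. {x. 0 \<le> eval g x}) \<inter> (\<Inter>i\<in>- I. {x. x i = 0})"
    by (auto simp: feasible_def)
  moreover have "closed {x. 0 \<le> eval g x}" for g
    by (intro closed_Collect_le continuous_on_const continuous_on_eval)
  moreover have "closed {x. (x::nat \<Rightarrow> real) i = 0}" for i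
    by (intro closed_Collect_eq continuous_on_const cont)
  ultimately have "closed ?K" by (metis (no_types, lifting) closed_INT closed_Int)
  have "?K \<subseteq> {x. \<forall>i. x i \<in> {- B' i..B' i}}"
    using B by (force simp: B'_def abs_le_iff)
  then have *: "{x. \<forall>i. x i \<in> {- B' i..B' i}} \<inter> ?K = ?K" by (rule Int_absorb1)
  show ?thesis
    using \<open>closed ?K\<close> * compact_Int_closed[OF compact_real_box[of B'], of ?K] by (simp only:)
qed

lemma continuous_on_Min_image:
  fixes f :: "'b \<Rightarrow> 'a::topological_space \<Rightarrow> real"
  assumes "finite T" "T \<noteq> {}" "\<And>t. t \<in> T \<Longrightarrow> continuous_on S (f t)"
  shows "continuous_on S (\<lambda>x. Min ((\<lambda>t. f t x) ` T))"
  using assms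
proof (induction T rule: finite_ne_induct)
  case (insert t T)
  then have "(\<lambda>x. Min ((\<lambda>t. f t x) ` insert t T)) = (\<lambda>x. min (f t x) (Min ((\<lambda>t. f t x) ` T)))"
    by simp
  then show ?case using insert by (simp add: continuous_on_min)
qed simp

text \<open>Points of \<open>S\<close> vanish off \<open>W\<close>, so distinct points differ in a
  coordinate from \<open>W\<close>, and polynomials in \<open>W\<close> separate them as
  Stone--Weierstrass requires.\<close>

lemma polynomial_approximation:
  assumes S: "compact S" and supp: "\<And>x i. x \<in> S \<Longrightarrow> i \<notin> W \<Longrightarrow> x i = 0"
    and q: "continuous_on S q" and e: "0 < e"
  shows "\<exists>r. vars_in W r \<and> (\<forall>x\<in>S. \<bar>q x - eval r x\<bar> < e)"
proof -
  interpret function_ring_on "{eval r | r. vars_in W r}" S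
  proof
    show "compact S" by fact
    show "continuous_on S f" if "f \<in> {eval r |r. vars_in W r}" for f
      using that continuous_on_eval by auto
    fix f g assume "f \<in> {eval r |r. vars_in W r}" "g \<in> {eval r |r. vars_in W r}"
    then obtain a b where "f = eval a" "g = eval b" "vars_in W a" "vars_in W b" by blast
    then have "(\<lambda>x. f x + g x) = eval (a + b) \<and> vars_in W (a + b)" "(\<lambda>x. f x * g x) = eval (a * b) \<and> vars_in W (a * b)"
      by (auto intro!: vars_in_add vars_in_mult simp: eval_add eval_mult)
    then show "(\<lambda>x. f x + g x) \<in> {eval r |r. vars_in W r}" "(\<lambda>x. f x * g x) \<in> {eval r |r. vars_in W r}"
      by blast+
  next
    show "(\<lambda>_. c) \<in> {eval r |r. vars_in W r}" for c
      by (auto intro!: exI[of _ "Const c"] simp: vars_in_Const eval_Const)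
    fix x y assume "x \<in> S" "y \<in> S" "x \<noteq> y"
    then obtain i where i: "x i \<noteq> y i" by blast
    moreover have "i \<in> W" using i supp[OF \<open>x \<in> S\<close>, of i] supp[OF \<open>y \<in> S\<close>, of i] by (cases "i \<in> W") auto
    ultimately show "\<exists>f\<in>{eval r |r. vars_in W r}. f x \<noteq> f y"
      by (auto intro!: exI[of _ "eval (Var i)"] simp: eval_Var vars_in_Var)
  qed
  show ?thesis using Stone_Weierstrass_basic[OF q e] by auto
qed

text \<open>The witness is a finite minimum of the functions \<open>z \<mapsto> F x + L |z - x|\<^sup>2\<close>, where \<open>x\<close> runs
  through a net in the first feasible set and the norm only sees the shared coordinates.\<close>

lemma separation:
  assumes G1: "ball_constrained I1 G1" and G2: "ball_constrained I2 G2"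
    and F1: "vars_in I1 F1" and F2: "vars_in I2 F2"
    and pos: "\<And>x. x \<in> feasible G1 \<Longrightarrow> x \<in> feasible G2 \<Longrightarrow> 0 < eval F1 x + eval F2 x"
  shows "\<exists>q. vars_in (I1 \<inter> I2) q \<and> (\<forall>x\<in>feasible G1. 0 < eval (F1 - q) x)
    \<and> (\<forall>x\<in>feasible G2. 0 < eval (F2 + q) x)"
proof -
  \<comment> \<open>Cutting to \<open>I\<close> changes no value of a polynomial in
    \<open>I\<close>, so estimates on the compact slices \<open>K1\<close> and \<open>K2\<close>
    extend to the full feasible cylinders.\<close>
  let ?W = "I1 \<inter> I2"
  define cut where "cut I x i = (if i \<in> I then x i else 0)" for I :: "nat set" and x :: "nat \<Rightarrow> real" and i
  define K1 where "K1 = {x \<in> feasible G1. \<forall>i. i \<notin> I1 \<longrightarrow> x i = 0}"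
  define K2 where "K2 = {x \<in> feasible G2. \<forall>i. i \<notin> I2 \<longrightarrow> x i = 0}"
  have comp: "compact K1" "compact K2"
    using compact_feasible G1 G2 by (auto simp: K1_def K2_def)
  have vars: "\<forall>g\<in>G1. vars_in I1 g" "\<forall>g\<in>G2. vars_in I2 g" "finite I1"
    using G1 G2 by (auto simp: ball_constrained_def)
  have cut1: "cut I1 x \<in> K1" if "x \<in> feasible G1" for x
    using feasible_cong[OF vars(1) _ that, of "cut I1 x"] by (auto simp: K1_def cut_def)
  have cut2: "cut I2 x \<in> K2" if "x \<in> feasible G2" for x
    using feasible_cong[OF vars(2) _ that, of "cut I2 x"] by (auto simp: K2_def cut_def)
  have cont_coord: "continuous_on S (\<lambda>x::nat \<Rightarrow> real. x i)" for S i
    by (rule continuous_on_subset[OF continuous_on_product_coordinates]) simp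
  define D where "D x y = (\<Sum>i\<in>?W. (x i - y i)\<^sup>2)" for x y :: "nat \<Rightarrow> real"
  have D_nonneg: "0 \<le> D x y" for x y by (auto simp: D_def intro: sum_nonneg)
  have D_zero: "D x y = 0 \<longleftrightarrow> (\<forall>i\<in>?W. x i = y i)" for x y
    unfolding D_def using vars(3) by (subst sum_nonneg_eq_0_iff) auto
  have cont_fst: "continuous_on S (\<lambda>p::(nat \<Rightarrow> real) \<times> (nat \<Rightarrow> real). fst p i)" for S i
    by (rule continuous_on_compose2[OF cont_coord[of UNIV] continuous_on_fst[OF continuous_on_id]]) auto
  have cont_snd: "continuous_on S (\<lambda>p::(nat \<Rightarrow> real) \<times> (nat \<Rightarrow> real). snd p i)" for S i
    by (rule continuous_on_compose2[OF cont_coord[of UNIV] continuous_on_snd[OF continuous_on_id]]) auto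
  have cont_D: "continuous_on S (\<lambda>p. D (fst p) (snd p))" for S
    unfolding D_def by (intro continuous_intros cont_fst cont_snd)
  have cont_D1: "continuous_on S (\<lambda>z. D z x)" for S x
    unfolding D_def by (intro continuous_intros cont_coord)
  define u where "u p = eval F1 (fst p) + eval F2 (snd p)" for p
  have cont_u: "continuous_on S u" for S
    unfolding u_def
    by (intro continuous_on_add continuous_on_compose2[OF continuous_on_eval[of UNIV]]
        continuous_on_fst continuous_on_snd continuous_on_id) auto
  let ?K = "K1 \<times> K2"
  have comp_K: "compact ?K" using comp by (rule compact_Times)
  \<comment> \<open>Points that agree on the shared coordinates merge into one point feasible for
    both blocks, where the positivity hypothesis applies.\<close>
  have glue: "0 < u (x, y)" if xy: "x \<in> K1" "y \<in> K2" "D x y = 0" for x y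
  proof -
    define z where "z i = (if i \<in> I1 then x i else y i)" for i
    have zx: "z i = x i" if "i \<in> I1" for i using that by (simp add: z_def)
    have zy: "z i = y i" if "i \<in> I2" for i using that xy(3) D_zero by (auto simp: z_def)
    have "z \<in> feasible G1" "z \<in> feasible G2"
      using xy feasible_cong[OF vars(1), of x z] feasible_cong[OF vars(2), of y z] zx zy
      by (auto simp: K1_def K2_def)
    then have "0 < eval F1 z + eval F2 z" by (rule pos)
    also have "eval F1 z = eval F1 x" by (rule eval_cong[OF F1 zx])
    also have "eval F2 z = eval F2 y" by (rule eval_cong[OF F2 zy])
    finally show ?thesis by (simp add: u_def)
  qed
  have "\<exists>L\<ge>0. \<forall>p\<in>?K. 0 < u p + L * D (fst p) (snd p)"
  proof -
    let ?N = "{p \<in> ?K. u p \<le> 0}"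
    have "?N = ?K \<inter> {p. u p \<le> 0}" by auto
    moreover have "closed {p. u p \<le> 0}"
      using cont_u[of UNIV] by (intro closed_Collect_le continuous_on_const)
    ultimately have comp_N: "compact ?N" using comp_K by auto
    show ?thesis
    proof (cases "?N = {}")
      case True
      then show ?thesis by (intro exI[of _ 0]) force
    next
      case False
      obtain p0 where p0: "p0 \<in> ?N" "\<And>p. p \<in> ?N \<Longrightarrow> D (fst p0) (snd p0) \<le> D (fst p) (snd p)"
        using continuous_attains_inf[OF comp_N False cont_D] by blast
      obtain p1 where p1: "p1 \<in> ?N" "\<And>p. p \<in> ?N \<Longrightarrow> u p1 \<le> u p"
        using continuous_attains_inf[OF comp_N False cont_u] by blast
      define d where "d = D (fst p0) (snd p0)"
      have "d \<noteq> 0" using glue[of "fst p0" "snd p0"] p0(1) by (auto simp: d_def)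
      then have d: "d > 0" using D_nonneg[of "fst p0" "snd p0"] by (simp add: d_def)
      \<comment> \<open>A penalty weight: where \<open>u\<close> is nonpositive,
        \<open>u \<ge> u p1\<close> and \<open>D \<ge> d\<close>, so the penalised sum is at least
        \<open>u p1 + L * d = 1\<close>.\<close>
      define L where "L = (1 - u p1) / d"
      have L: "L \<ge> 0" "L * d = 1 - u p1" using d p1(1) by (auto simp: L_def)
      show ?thesis
      proof (intro exI[of _ L] conjI ballI L)
        fix p assume p: "p \<in> ?K"
        show "0 < u p + L * D (fst p) (snd p)"
        proof (cases "u p \<le> 0")
          case True
          then have "L * d \<le> L * D (fst p) (snd p)" "u p1 \<le> u p"
            using p0(2)[of p] p1(2)[of p] p L(1) by (auto simp: d_def intro: mult_left_mono)
          then show ?thesis using L(2) by linarith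
        next
          case False
          then show ?thesis using D_nonneg[of "fst p" "snd p"] L(1)
            by (smt (verit) mult_nonneg_nonneg)
        qed
      qed
    qed
  qed
  then obtain L where L: "L \<ge> 0" and Lpos: "\<And>p. p \<in> ?K \<Longrightarrow> 0 < u p + L * D (fst p) (snd p)" by blast
  have "\<exists>e>0. \<forall>p\<in>?K. e \<le> u p + L * D (fst p) (snd p)"
  proof (cases "?K = {}")
    case False
    have "continuous_on ?K (\<lambda>p. u p + L * D (fst p) (snd p))"
      by (intro continuous_intros cont_u cont_D)
    from continuous_attains_inf[OF comp_K False this] show ?thesis using Lpos by blast
  qed (auto intro: exI[of _ 1])
  then obtain e where e: "e > 0"
    and Le: "\<And>x y. x \<in> K1 \<Longrightarrow> y \<in> K2 \<Longrightarrow> e \<le> eval F1 x + eval F2 y + L * D x y"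
    by (force simp: u_def)
  \<comment> \<open>Near \<open>x\<close>, the penalised value anchored at \<open>x\<close> exceeds
    \<open>F1\<close> by less than \<open>e/4\<close>. A finite subcover supplies the net
    \<open>T\<close>.\<close>
  define U where "U x = {z. eval F1 x + L * D z x < eval F1 z + e/4}" for x
  have "open (U x)" for x
    unfolding U_def
    by (intro open_Collect_less continuous_on_add continuous_on_mult continuous_on_const
        continuous_on_eval cont_D1)
  moreover have "x \<in> U x" for x using e D_zero[of x x] by (simp add: U_def)
  then have "K1 \<subseteq> (\<Union>x\<in>K1. U x)" by blast
  ultimately obtain T where T: "T \<subseteq> K1" "finite T" "K1 \<subseteq> (\<Union>x\<in>T. U x)"
    by (rule compactE_image[OF comp(1)])
  have "\<exists>q. continuous_on UNIV q \<and> (\<forall>x\<in>K1. q x < eval F1 x + e/4) \<and> (\<forall>y\<in>K2. e \<le> eval F2 y + q y)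
    \<and> (\<forall>x. q (cut ?W x) = q x)"
  proof (cases "T = {}")
    \<comment> \<open>The minimum needs a nonempty net. Here \<open>K1\<close> is empty, and a
      constant large enough for \<open>F2\<close> on \<open>K2\<close> suffices.\<close>
    case True
    then have "K1 = {}" using T by auto
    obtain b where "\<And>y. y \<in> K2 \<Longrightarrow> b \<le> eval F2 y"
      using continuous_attains_inf[OF comp(2) _ continuous_on_eval[of K2 F2]]
      by (cases "K2 = {}") force+
    then show ?thesis using \<open>K1 = {}\<close> by (intro exI[of _ "\<lambda>_. e - b"]) force
  next
    case False
    define q where "q z = Min ((\<lambda>x. eval F1 x + L * D z x) ` T)" for z
    have "continuous_on UNIV q"
      unfolding q_def by (rule continuous_on_Min_image[OF T(2) False])
        (intro continuous_intros cont_D1)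
    moreover have "q x < eval F1 x + e/4" if x: "x \<in> K1" for x
    proof -
      obtain t where t: "t \<in> T" "x \<in> U t" using T x by blast
      then have "q x \<le> eval F1 t + L * D x t" unfolding q_def using T by (intro Min_le) auto
      then show ?thesis using t by (auto simp: U_def)
    qed
    moreover have "e \<le> eval F2 y + q y" if y: "y \<in> K2" for y
    proof -
      have "q y \<in> (\<lambda>x. eval F1 x + L * D y x) ` T"
        unfolding q_def using T False by (intro Min_in) auto
      then obtain t where t: "t \<in> T" "q y = eval F1 t + L * D y t" by blast
      moreover have "D y t = D t y" by (simp add: D_def power2_commute)
      ultimately show ?thesis using Le[of t y] y T by auto
    qed
    \<comment> \<open>Since \<open>q\<close> sees only shared coordinates, approximating it on the
      projection of \<open>K1 \<union> K2\<close> to them yields a polynomial in shared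
      variables.\<close>
    moreover have "D (cut ?W z) x = D z x" for z x by (auto simp: D_def cut_def intro: sum.cong)
    then have "q (cut ?W z) = q z" for z by (simp add: q_def)
    ultimately show ?thesis by blast
  qed
  then obtain q where q: "continuous_on UNIV q" "\<And>x. x \<in> K1 \<Longrightarrow> q x < eval F1 x + e/4"
    "\<And>y. y \<in> K2 \<Longrightarrow> e \<le> eval F2 y + q y" "\<And>x. q (cut ?W x) = q x" by blast
  let ?S = "cut ?W ` (K1 \<union> K2)"
  have cont_cut: "continuous_on S (cut I)" for S I
  proof (rule continuous_on_coordinatewise_then_product)
    show "continuous_on S (\<lambda>x. cut I x i)" for i
      by (cases "i \<in> I") (simp_all add: cut_def cont_coord)
  qed
  have "compact ?S" using comp by (intro compact_continuous_image cont_cut compact_Un)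
  moreover have "x i = 0" if "x \<in> ?S" "i \<notin> ?W" for x i using that by (auto simp: cut_def)
  moreover have "continuous_on ?S q" using continuous_on_subset[OF q(1)] by blast
  moreover have "0 < e/4" using e by simp
  ultimately have "\<exists>r. vars_in ?W r \<and> (\<forall>x\<in>?S. \<bar>q x - eval r x\<bar> < e/4)"
    by (rule polynomial_approximation)
  then obtain r where r: "vars_in ?W r" "\<And>x. x \<in> ?S \<Longrightarrow> \<bar>q x - eval r x\<bar> < e/4" by blast
  have r_close: "\<bar>q x - eval r x\<bar> < e/4" if "x \<in> K1 \<union> K2" for x
  proof -
    have "eval r (cut ?W x) = eval r x" by (rule eval_cong[OF r(1)]) (simp add: cut_def)
    then show ?thesis using r(2)[of "cut ?W x"] that q(4) by auto
  qed
  have r12: "vars_in I1 r" "vars_in I2 r" using vars_in_mono[OF r(1)] by auto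
  show ?thesis
  \<comment> \<open>Error budget: \<open>r < F1 + e/2\<close> on \<open>K1\<close> and
    \<open>F2 + r > 3 e/4\<close> on \<open>K2\<close>, so a shift by \<open>e/2\<close> keeps both
    differences positive.\<close>
  proof (intro exI[of _ "r - Const (e/2)"] conjI ballI)
    show "vars_in ?W (r - Const (e/2))" using r(1) by (intro vars_in_diff vars_in_Const)
    fix x
    show "0 < eval (F1 - (r - Const (e/2))) x" if x: "x \<in> feasible G1"
    proof -
      let ?x = "cut I1 x"
      have "eval F1 ?x = eval F1 x" "eval r ?x = eval r x"
        by (rule eval_cong[OF F1] eval_cong[OF r12(1)], simp add: cut_def)+
      then show ?thesis
        using q(2)[OF cut1[OF x]] r_close[of ?x] cut1[OF x]
        unfolding eval_diff eval_Const abs_less_iff by (simp add: field_simps)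
    qed
    show "0 < eval (F2 + (r - Const (e/2))) x" if x: "x \<in> feasible G2"
    proof -
      let ?x = "cut I2 x"
      have "eval F2 ?x = eval F2 x" "eval r ?x = eval r x"
        by (rule eval_cong[OF F2] eval_cong[OF r12(2)], simp add: cut_def)+
      then show ?thesis
        using q(3)[OF cut2[OF x]] r_close[of ?x] cut2[OF x]
        unfolding eval_diff eval_add eval_Const abs_less_iff by (simp add: field_simps)
    qed
  qed
qed

section \<open>Induction along the running intersection property\<close>

lemma ball_constrained_Union:
  assumes "finite K" "\<And>k. k \<in> K \<Longrightarrow> ball_constrained (I k) (G k)"
  shows "ball_constrained (\<Union>k\<in>K. I k) (\<Union>k\<in>K. G k)"
  unfolding ball_constrained_def
proof (intro conjI ballI)
  show "finite (\<Union>k\<in>K. I k)" using assms by (auto simp: ball_constrained_def)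
  fix g assume "g \<in> (\<Union>k\<in>K. G k)"
  then show "vars_in (\<Union>k\<in>K. I k) g"
    using assms(2) vars_in_mono[of _ g "\<Union>k\<in>K. I k"] unfolding ball_constrained_def by blast
next
  fix i assume "i \<in> (\<Union>k\<in>K. I k)"
  then obtain k where k: "k \<in> K" "i \<in> I k" by blast
  then obtain B where "\<forall>x\<in>feasible (G k). \<bar>x i\<bar> \<le> B"
    using assms(2)[OF k(1)] by (auto simp: ball_constrained_def)
  moreover have "feasible (\<Union>k\<in>K. G k) \<subseteq> feasible (G k)" using k by (auto simp: feasible_def)
  ultimately show "\<exists>B. \<forall>x\<in>feasible (\<Union>k\<in>K. G k). \<bar>x i\<bar> \<le> B" by blast
qed

lemma ball_constrainedI:
  assumes "finite I" "\<forall>g\<in>G. vars_in I g" "Const N - (\<Sum>i\<in>I. Var i * Var i) \<in> G"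
  shows "ball_constrained I G"
  unfolding ball_constrained_def
proof (intro conjI ballI exI)
  fix i x assume "i \<in> I" "x \<in> feasible G"
  then have "(\<Sum>i\<in>I. x i * x i) \<le> N"
    using assms(3) by (fastforce simp: feasible_def eval_diff eval_Const eval_sum eval_mult eval_Var)
  moreover have "x i * x i \<le> (\<Sum>i\<in>I. x i * x i)"
    using \<open>i \<in> I\<close> assms(1) by (intro member_le_sum) auto
  ultimately have "(x i)\<^sup>2 \<le> N" by (simp add: power2_eq_square)
  then show "\<bar>x i\<bar> \<le> sqrt N" using real_sqrt_le_mono[of "(x i)\<^sup>2" N] by simp
qed (use assms in auto)

lemma sparse_decomposition:
  assumes "1 \<le> p" "RIP p I"
    and "\<forall>k\<in>{1..p}. ball_constrained (I k) (G k)"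
    and "\<forall>k\<in>{1..p}. vars_in (I k) (f k)"
    and "\<And>x. (\<forall>k\<in>{1..p}. x \<in> feasible (G k)) \<Longrightarrow> 0 < eval (\<Sum>k=1..p. f k) x"
  shows "\<exists>h. (\<Sum>k=1..p. h k) = (\<Sum>k=1..p. f k)
    \<and> (\<forall>k\<in>{1..p}. vars_in (I k) (h k) \<and> (\<forall>x\<in>feasible (G k). 0 < eval (h k) x))"
  using assms
\<comment> \<open>The summands are generalised because the induction hypothesis is applied to
  \<open>f'\<close>, in which block \<open>i\<close> has absorbed the correction.\<close>
proof (induction p arbitrary: f rule: dec_induct)
  case base
  then show ?case by (intro exI[of _ f]) auto
next
  case (step p)
  let ?U = "\<Union>k\<in>{1..p}. I k"
  \<comment> \<open>For \<open>Suc p\<close> blocks the property is available at index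
    \<open>p\<close>, and that instance concerns the block \<open>I (Suc p)\<close> being split
    off.\<close>
  have "p \<in> {1..Suc p - 1}" using step.hyps by simp
  then obtain i where i: "i \<in> {1..p}" "I (Suc p) \<inter> ?U \<subseteq> I i"
    using step.prems(1) unfolding RIP_def by (metis Suc_eq_plus1)
  have f: "vars_in (I k) (f k)" if "k \<in> {1..Suc p}" for k using step.prems(3) that by blast
  have "\<exists>q. vars_in (?U \<inter> I (Suc p)) q
    \<and> (\<forall>x\<in>feasible (\<Union>k\<in>{1..p}. G k). 0 < eval ((\<Sum>k=1..p. f k) - q) x)
    \<and> (\<forall>x\<in>feasible (G (Suc p)). 0 < eval (f (Suc p) + q) x)"
  proof (rule separation)
    show "ball_constrained ?U (\<Union>k\<in>{1..p}. G k)"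
      using step.prems(2) by (intro ball_constrained_Union) auto
    show "ball_constrained (I (Suc p)) (G (Suc p))" using step.prems(2) by simp
    show "vars_in ?U (\<Sum>k=1..p. f k)"
      using f by (intro vars_in_sum vars_in_mono[OF f]) auto
    show "vars_in (I (Suc p)) (f (Suc p))" by (rule f) simp
    fix x assume "x \<in> feasible (\<Union>k\<in>{1..p}. G k)" "x \<in> feasible (G (Suc p))"
    then have "\<forall>k\<in>{1..Suc p}. x \<in> feasible (G k)"
      by (auto simp: feasible_def le_Suc_eq)
    then show "0 < eval (\<Sum>k=1..p. f k) x + eval (f (Suc p)) x"
      using step.prems(4) step.hyps by (simp add: eval_add)
  qed
  then obtain q where q: "vars_in (?U \<inter> I (Suc p)) q"
    "\<And>x. x \<in> feasible (\<Union>k\<in>{1..p}. G k) \<Longrightarrow> 0 < eval ((\<Sum>k=1..p. f k) - q) x"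
    "\<And>x. x \<in> feasible (G (Suc p)) \<Longrightarrow> 0 < eval (f (Suc p) + q) x" by blast
  define f' where "f' k = f k - (if k = i then q else 0)" for k
  have sum_f': "(\<Sum>k=1..p. f' k) = (\<Sum>k=1..p. f k) - q"
    using i(1) by (simp add: f'_def sum_subtractf)
  have "\<exists>h. (\<Sum>k=1..p. h k) = (\<Sum>k=1..p. f' k)
    \<and> (\<forall>k\<in>{1..p}. vars_in (I k) (h k) \<and> (\<forall>x\<in>feasible (G k). 0 < eval (h k) x))"
  proof (rule step.IH)
    show "RIP p I" using step.prems(1) unfolding RIP_def by auto
    show "\<forall>k\<in>{1..p}. ball_constrained (I k) (G k)" using step.prems(2) by simp
    have "vars_in (I i) q" using q(1) i(2) by (auto intro: vars_in_mono)
    then show "\<forall>k\<in>{1..p}. vars_in (I k) (f' k)"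
      using f by (auto simp: f'_def intro!: vars_in_diff)
    show "0 < eval (\<Sum>k=1..p. f' k) x" if "\<forall>k\<in>{1..p}. x \<in> feasible (G k)" for x
      unfolding sum_f' using that by (intro q(2)) (auto simp: feasible_def)
  qed
  then obtain h where h: "(\<Sum>k=1..p. h k) = (\<Sum>k=1..p. f' k)"
    "\<And>k. k \<in> {1..p} \<Longrightarrow> vars_in (I k) (h k)"
    "\<And>k x. k \<in> {1..p} \<Longrightarrow> x \<in> feasible (G k) \<Longrightarrow> 0 < eval (h k) x" by blast
  define h' where "h' = h(Suc p := f (Suc p) + q)"
  have "(\<Sum>k=1..p. h' k) = (\<Sum>k=1..p. h k)" by (intro sum.cong) (auto simp: h'_def)
  then have "(\<Sum>k=1..Suc p. h' k) = (\<Sum>k=1..Suc p. f k)"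
    using h(1) sum_f' by (simp add: h'_def)
  moreover have "vars_in (I k) (h' k)" if "k \<in> {1..Suc p}" for k
    using that h(2)[of k] f[of k] vars_in_mono[OF q(1), of "I (Suc p)"]
    by (cases "k = Suc p") (auto simp: h'_def intro: vars_in_add)
  moreover have "0 < eval (h' k) x" if "k \<in> {1..Suc p}" "x \<in> feasible (G k)" for k x
    using that h(3)[of k] q(3)[of x] by (cases "k = Suc p") (auto simp: h'_def)
  ultimately show ?case by blast
qed

theorem theorem8p4:
  fixes n m p :: nat
    and f :: mpoly and g :: "nat \<Rightarrow> mpoly"
    and I J :: "nat \<Rightarrow> nat set"
  assumes p_pos: "p \<ge> 1"
    and f_poly: "vars_in {1..n} f"
    and g_poly: "\<forall>j\<in>{1..m}. vars_in {1..n} (g j)"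
    and I_sub: "\<forall>k\<in>{1..p}. I k \<subseteq> {1..n}"
    and I_cover: "(\<Union>k\<in>{1..p}. I k) = {1..n}"
    and J_cover: "(\<Union>k\<in>{1..p}. J k) = {1..m}"
    and J_disj: "\<forall>k\<in>{1..p}. \<forall>l\<in>{1..p}. k \<noteq> l \<longrightarrow> J k \<inter> J l = {}"
    and sep_f: "\<exists>fk :: nat \<Rightarrow> mpoly. f = (\<Sum>k=1..p. fk k) \<and> (\<forall>k\<in>{1..p}. vars_in (I k) (fk k))"
    and sep_g: "\<forall>k\<in>{1..p}. \<forall>j\<in>J k. vars_in (I k) (g j)"
    and rip: "RIP p I"
    and ball: "\<forall>k\<in>{1..p}. \<exists>N>0. \<exists>j\<in>J k. g j = Const N - (\<Sum>i\<in>I k. Var i * Var i)"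
    and f_pos: "\<forall>x. (\<forall>j\<in>{1..m}. eval (g j) x \<ge> 0) \<longrightarrow> eval f x > 0"
  shows "\<exists>\<sigma> :: nat \<Rightarrow> nat \<Rightarrow> mpoly.
           f = (\<Sum>k=1..p. \<sigma> k 0 + (\<Sum>j\<in>J k. \<sigma> k j * g j))
         \<and> (\<forall>k\<in>{1..p}. \<forall>j\<in>insert 0 (J k).
              sos_in (I k) (\<sigma> k j)
            \<and> (\<forall>\<alpha>\<in>supp (\<sigma> k j).
                 \<forall>S\<in>sign_symmetries n (supp f \<union> (\<Union>j'\<in>{1..m}. supp (g j'))).
                   even (sdot S \<alpha>)))"
proof -
  define \<S> where "\<S> = sign_symmetries n (supp f \<union> (\<Union>j'\<in>{1..m}. supp (g j')))"
  obtain fk where fk: "f = (\<Sum>k=1..p. fk k)" "\<forall>k\<in>{1..p}. vars_in (I k) (fk k)"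
    using sep_f by blast
  have J_sub: "J k \<subseteq> {1..m}" if "k \<in> {1..p}" for k using J_cover that by blast
  have fin: "finite (I k)" "finite (J k)" if "k \<in> {1..p}" for k
    using I_sub J_sub that finite_subset[OF _ finite_atLeastAtMost] by blast+
  have constrained: "ball_constrained (I k) (g ` J k)" if k: "k \<in> {1..p}" for k
  proof -
    obtain N where "Const N - (\<Sum>i\<in>I k. Var i * Var i) \<in> g ` J k" using ball k by (metis image_eqI)
    moreover have "\<forall>q\<in>g ` J k. vars_in (I k) q" using sep_g k by blast
    ultimately show ?thesis by (intro ball_constrainedI fin(1)[OF k])
  qed
  have "\<exists>h. (\<Sum>k=1..p. h k) = (\<Sum>k=1..p. fk k)
    \<and> (\<forall>k\<in>{1..p}. vars_in (I k) (h k) \<and> (\<forall>x\<in>feasible (g ` J k). 0 < eval (h k) x))"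
  proof (rule sparse_decomposition[OF p_pos rip _ fk(2)])
    show "0 < eval (\<Sum>k=1..p. fk k) x" if x: "\<forall>k\<in>{1..p}. x \<in> feasible (g ` J k)" for x
    proof -
      have "0 \<le> eval (g j) x" if "j \<in> {1..m}" for j
      proof -
        have "j \<in> (\<Union>k\<in>{1..p}. J k)" using J_cover that by simp
        then obtain k where "k \<in> {1..p}" "j \<in> J k" by (rule UN_E)
        then show ?thesis using x by (auto simp: feasible_def)
      qed
      then have "0 < eval f x" by (intro f_pos[rule_format]) auto
      then show ?thesis by (simp only: fk(1))
    qed
    show "\<forall>k\<in>{1..p}. ball_constrained (I k) (g ` J k)" using constrained by (rule ballI)
  qed
  then obtain h where h: "(\<Sum>k=1..p. h k) = f" "\<And>k. k \<in> {1..p} \<Longrightarrow> vars_in (I k) (h k)"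
    "\<And>k x. k \<in> {1..p} \<Longrightarrow> x \<in> feasible (g ` J k) \<Longrightarrow> 0 < eval (h k) x"
    unfolding fk(1)[symmetric] by blast
  have "\<exists>\<tau>. h k = \<tau> 0 + (\<Sum>j\<in>J k. \<tau> j * g j) \<and> (\<forall>j\<in>insert 0 (J k). sos_in (I k) (\<tau> j))"
    if k: "k \<in> {1..p}" for k
  proof -
    obtain N j where "j \<in> J k" "g j = Const N - (\<Sum>i\<in>I k. Var i * Var i)" using ball k by blast
    then have "\<exists>\<sigma>0 \<sigma>. h k = \<sigma>0 + (\<Sum>j\<in>J k. \<sigma> j * g j) \<and> sos_in (I k) \<sigma>0 \<and> (\<forall>j\<in>J k. sos_in (I k) (\<sigma> j))"
      using sep_g k by (intro putinar_positivstellensatz[of _ _ _ N] fin h(2,3) ballI)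
        (auto simp: feasible_def)
    then obtain \<sigma>0 \<sigma> where \<sigma>: "h k = \<sigma>0 + (\<Sum>j\<in>J k. \<sigma> j * g j)" "sos_in (I k) \<sigma>0"
      "\<forall>j\<in>J k. sos_in (I k) (\<sigma> j)" by blast
    \<comment> \<open>Constraint indices start at 1, so index 0 is free to hold the multiplier
      without a constraint.\<close>
    have "0 \<notin> J k" using J_sub[OF k] by auto
    then have "(\<Sum>j\<in>J k. (\<sigma>(0 := \<sigma>0)) j * g j) = (\<Sum>j\<in>J k. \<sigma> j * g j)"
      by (intro sum.cong) auto
    then show ?thesis using \<sigma> by (intro exI[of _ "\<sigma>(0 := \<sigma>0)"]) auto
  qed
  then obtain \<tau> where \<tau>: "\<And>k. k \<in> {1..p} \<Longrightarrow> h k = \<tau> k 0 + (\<Sum>j\<in>J k. \<tau> k j * g j)"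
    "\<And>k j. k \<in> {1..p} \<Longrightarrow> j \<in> insert 0 (J k) \<Longrightarrow> sos_in (I k) (\<tau> k j)" by metis
  have even_f: "parity_class \<S> \<alpha> = {}" if "\<alpha> \<in> supp f" for \<alpha>
    using that by (auto simp: \<S>_def parity_class_def sign_symmetries_def)
  have even_g: "parity_class \<S> \<alpha> = {}" if "j \<in> {1..m}" "\<alpha> \<in> supp (g j)" for j \<alpha>
    using that unfolding \<S>_def parity_class_def sign_symmetries_def by blast
  define \<sigma> where "\<sigma> k j = even_part \<S> (\<tau> k j)" for k j
  have "f = even_part \<S> (\<Sum>k=1..p. h k)"
    unfolding h(1) by (rule restrict_supp_id[symmetric, OF even_f])
  also have "\<dots> = (\<Sum>k=1..p. even_part \<S> (h k))" by (rule restrict_supp_sum)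
  also have "\<dots> = (\<Sum>k=1..p. \<sigma> k 0 + (\<Sum>j\<in>J k. \<sigma> k j * g j))"
  proof (rule sum.cong[OF refl])
    fix k assume k: "k \<in> {1..p}"
    have "even_part \<S> (h k) = even_part \<S> (\<tau> k 0) + (\<Sum>j\<in>J k. even_part \<S> (\<tau> k j * g j))"
      by (simp add: \<tau>(1)[OF k] restrict_supp_add restrict_supp_sum)
    also have "(\<Sum>j\<in>J k. even_part \<S> (\<tau> k j * g j)) = (\<Sum>j\<in>J k. \<sigma> k j * g j)"
      unfolding \<sigma>_def using J_sub[OF k] even_g by (intro sum.cong refl even_part_mult) blast
    finally show "even_part \<S> (h k) = \<sigma> k 0 + (\<Sum>j\<in>J k. \<sigma> k j * g j)" by (simp add: \<sigma>_def)
  qed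
  finally have "f = (\<Sum>k=1..p. \<sigma> k 0 + (\<Sum>j\<in>J k. \<sigma> k j * g j))" .
  moreover have "sos_in (I k) (\<sigma> k j)" if "k \<in> {1..p}" "j \<in> insert 0 (J k)" for k j
    unfolding \<sigma>_def by (intro sos_in_even_part \<tau>(2) that)
  moreover have "even (sdot S \<alpha>)" if "\<alpha> \<in> supp (\<sigma> k j)" "S \<in> \<S>" for k j \<alpha> S
    using that by (auto simp: \<sigma>_def supp_restrict_supp parity_class_def)
  ultimately show ?thesis unfolding \<S>_def by blast
qed

end
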